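(* For all $k \ge 5$ and $n \ge (k+1)2^{k-4}$, $$ n-1 \le \mathrm{sat}^\ast(n,P_k) \le \begin{cases} 9\left\lfloor\frac{n}{9}\right\rfloor+\binom{n-9\left\lfloor \frac{n}{9} \right\rfloor}{2}, & k=5, \\ n+(k-5)2^{k-5}, & k\ge6. \end{cases} $$ In particular, $\mathrm{sat}^\ast(n,P_k)=n+O(1)$ for all (fixed) $k \ge 5$, and $\mathrm{sat}^\ast(n,P_5)=n-1$ for infinitely many $n$.
   Context: All graphs are finite and simple. $P_k$ denotes the path on $k$ vertices. An edge-colouring of a graph is proper if any two distinct edges sharing a vertex receive different colours. A rainbow copy of $H$ in an edge-coloured graph $G$ is a subgraph of $G$ isomorphic to $H$ all of whose edges have distinct colours. A graph $G$ is properly rainbow $H$-saturated if (1) there is a proper edge-colouring of $G$ containing no rainbow copy of $H$, and (2) for every non-edge $e \notin E(G)$ (a pair of distinct non-adjacent vertices of $G$), every proper edge-colouring of $G+e$ contains a rainbow copy of $H$. The proper rainbow saturation number $\mathrm{sat}^\ast(n,H)$ is the minimum number of edges in a properly rainbow $H$-saturated graph on $n$ vertices. The $O(1)$ term is as $n\to\infty$ with $k$ fixed, i.e. it is bounded in absolute value by a constant depending only on $k$. *)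

theory Defs
  imports Complex_Main "HOL-Library.Landau_Symbols"
begin

type_synonym 'a sgraph = "'a set \<times> 'a set set"

abbreviation verts :: "'a sgraph \<Rightarrow> 'a set" where
  "verts G \<equiv> fst G"

abbreviation edges :: "'a sgraph \<Rightarrow> 'a set set" where
  "edges G \<equiv> snd G"

definition simple_graph :: "'a sgraph \<Rightarrow> bool" where
  "simple_graph G \<longleftrightarrow>
     finite (verts G) \<and> (\<forall>e\<in>edges G. e \<subseteq> verts G \<and> card e = 2)"

definition subgraph :: "'a sgraph \<Rightarrow> 'a sgraph \<Rightarrow> bool" where
  "subgraph S G \<longleftrightarrow>
     simple_graph S \<and> verts S \<subseteq> verts G \<and> edges S \<subseteq> edges G"

definition graph_iso :: "'b sgraph \<Rightarrow> 'a sgraph \<Rightarrow> bool" where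
  "graph_iso H S \<longleftrightarrow>
     (\<exists>f. bij_betw f (verts H) (verts S) \<and> (\<lambda>e. f ` e) ` edges H = edges S)"

definition path_graph :: "nat \<Rightarrow> nat sgraph" where
  "path_graph k = ({..<k}, {{i, Suc i} | i. Suc i < k})"

definition add_edge :: "'a sgraph \<Rightarrow> 'a set \<Rightarrow> 'a sgraph" where
  "add_edge G e = (verts G, insert e (edges G))"

definition non_edges :: "'a sgraph \<Rightarrow> 'a set set" where
  "non_edges G = {e. e \<subseteq> verts G \<and> card e = 2 \<and> e \<notin> edges G}"

text \<open>Colours are natural numbers, which loses no generality because all graphs are finite.
  Only the values of a colouring on the edges of the graph matter.\<close>

definition proper_colouring :: "'a sgraph \<Rightarrow> ('a set \<Rightarrow> nat) \<Rightarrow> bool" where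
  "proper_colouring G c \<longleftrightarrow>
     (\<forall>e\<in>edges G. \<forall>e'\<in>edges G. e \<noteq> e' \<and> e \<inter> e' \<noteq> {} \<longrightarrow> c e \<noteq> c e')"

definition has_rainbow_copy :: "'b sgraph \<Rightarrow> 'a sgraph \<Rightarrow> ('a set \<Rightarrow> nat) \<Rightarrow> bool" where
  "has_rainbow_copy H G c \<longleftrightarrow>
     (\<exists>S. subgraph S G \<and> graph_iso H S \<and> inj_on c (edges S))"

definition properly_rainbow_saturated :: "'b sgraph \<Rightarrow> 'a sgraph \<Rightarrow> bool" where
  "properly_rainbow_saturated H G \<longleftrightarrow>
     (\<exists>c. proper_colouring G c \<and> \<not> has_rainbow_copy H G c) \<and>
     (\<forall>e\<in>non_edges G. \<forall>c.
        proper_colouring (add_edge G e) c \<longrightarrow> has_rainbow_copy H (add_edge G e) c)"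

text \<open>Every finite graph is isomorphic to one with natural-number vertices. The infimum is over
  a set of naturals, so it is attained whenever the set is nonempty, which it is as soon as
  \<open>H\<close> has an edge: an edge-maximal graph satisfying the first condition is saturated.\<close>

definition sat_star :: "nat \<Rightarrow> 'b sgraph \<Rightarrow> nat" where
  "sat_star n H =
     Inf {card (edges G) | G :: nat sgraph.
            simple_graph G \<and> card (verts G) = n \<and> properly_rainbow_saturated H G}"

end

theory Submission imports Defs
begin

text \<open>Lower bound: call a vertex a good end if it is isolated, or a leaf whose neighbour has at
  most one non-leaf neighbour. A union of components without good ends has at least as many edges
  as vertices, because deleting its leaves leaves minimum degree two. Two good ends in different components
  can be joined by an edge after permuting the colours of one component, and the only rainbow
  paths through the new edge have at most four vertices. So in a saturated graph all good ends
  lie in one component.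

  Upper bound: an extremal graph need only be saturated up to few edges, since an edge-maximal
  graph with a good colouring is saturated. For \<open>k = 5\<close> take disjoint triangles with two pendant
  edges at each vertex, for \<open>k = 6\<close> a \<open>K\<^sub>4\<close> with pendant edges, and for \<open>k \<ge> 7\<close> a complete
  bipartite graph with parts of sizes \<open>s = (k - 3) div 2\<close> and \<open>5 * s - 1\<close>, with pendant edges at
  one vertex (\<open>k\<close> odd) or at all vertices (\<open>k\<close> even) of the large part. The last graph contains no
  path on \<open>k\<close> vertices, yet any edge added outside the small part creates so many that one of
  them is rainbow.\<close>

section \<open>Rainbow paths and saturation\<close>

text \<open>Condition (2) ranges over all proper colourings, so nothing is known about a colouring
  of the enlarged graph. For k >= 7 greedy counting deals with this: distinct neighbours of a vertex
  receive distinct colours, so a rainbow path extends once the candidates outnumber the used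
  vertices and colours. A path threaded through the small part gains, per visited vertex, one used
  vertex of the large part and two used colours, which block both edges of the next detour: 1 + 2 +
  2 = 5. The exact size 5 * s - 1 is dictated by the tightest case of \<open>inner_edge\<close>. The
  size s makes the longest path have k - 1 vertices, so any injective colouring witnesses condition
  (1). The counting needs two vertices in the small part, hence k >= 7. The graphs for k = 5 and k =
  6 do contain paths on k vertices; there rigidity replaces counting: the absence of a rainbow path
  forces coincidences of colours, which leave a new edge no harmless colour.\<close>

fun path_edges :: "'a list \<Rightarrow> 'a set list" where
  "path_edges (x # y # p) = {x, y} # path_edges (y # p)"
| "path_edges _ = []"

definition rainbow_path :: "'a set set \<Rightarrow> ('a set \<Rightarrow> nat) \<Rightarrow> 'a list \<Rightarrow> bool" where
  "rainbow_path E c p \<longleftrightarrow>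
     distinct p \<and> set (path_edges p) \<subseteq> E \<and> distinct (map c (path_edges p))"

lemma path_edges_append: "path_edges (u @ x # v) = path_edges (u @ [x]) @ path_edges (x # v)"
proof (induction u)
  case (Cons y u)
  then show ?case by (cases u) auto
qed simp

lemma path_edges_snoc: "path_edges (u @ [x, y]) = path_edges (u @ [x]) @ [{x, y}]"
  using path_edges_append[of u x "[y]"] by simp

lemma path_edges_conv_nth: "path_edges p = map (\<lambda>i. {p ! i, p ! Suc i}) [0..<length p - 1]"
proof (induction p rule: path_edges.induct)
  case (1 x y p)
  have "[0..<length (x # y # p) - 1] = 0 # map Suc [0..<length (y # p) - 1]"
    by (simp add: map_Suc_upt upt_conv_Cons del: upt_Suc)
  then show ?case using 1 by simp
qed auto

lemma length_path_edges: "length (path_edges p) = length p - 1"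
  by (simp add: path_edges_conv_nth)

lemma path_edges_subset: "e \<in> set (path_edges p) \<Longrightarrow> e \<subseteq> set p"
  by (induction p rule: path_edges.induct) auto

lemma path_edges_rev: "path_edges (rev p) = rev (path_edges p)"
proof (induction p rule: path_edges.induct)
  case (1 x y p)
  then show ?case using path_edges_snoc[of "rev p" y x] by (simp add: insert_commute)
qed auto

lemma path_edges_split:
  assumes "{x, y} \<in> set (path_edges p)"
  shows "\<exists>u v. p = u @ x # y # v \<or> p = u @ y # x # v"
  using assms
proof (induction p rule: path_edges.induct)
  case (1 a b p)
  show ?case
  proof (cases "{x, y} = {a, b}")
    case True
    then have "(x = a \<and> y = b) \<or> (x = b \<and> y = a)" by (simp add: doubleton_eq_iff)
    then show ?thesis by (intro exI[of _ "[]"] exI[of _ p]) auto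
  next
    case False
    then obtain u v where "b # p = u @ x # y # v \<or> b # p = u @ y # x # v" using 1 by auto
    then show ?thesis by (intro exI[of _ "a # u"] exI[of _ v]) auto
  qed
qed auto

lemma distinct_path_edges: "distinct p \<Longrightarrow> distinct (path_edges p)"
proof (induction p rule: path_edges.induct)
  case (1 x y p)
  then show ?case using path_edges_subset[of "{x, y}" "y # p"] by auto
qed auto

lemma rainbow_path_rev: "rainbow_path E c (rev p) \<longleftrightarrow> rainbow_path E c p"
  by (simp add: rainbow_path_def path_edges_rev flip: rev_map)

lemma rainbow_path_append1: "rainbow_path E c (p @ q) \<Longrightarrow> rainbow_path E c p"
proof (cases p rule: rev_cases)
  case (snoc u x)
  assume "rainbow_path E c (p @ q)"
  with snoc show ?thesis using path_edges_append[of u x q] by (auto simp: rainbow_path_def)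
qed (simp add: rainbow_path_def)

lemma rainbow_path_append2: "rainbow_path E c (p @ q) \<Longrightarrow> rainbow_path E c q"
  using rainbow_path_append1[of E c "rev q" "rev p"] by (metis rainbow_path_rev rev_append)

lemma rainbow_path_snoc:
  "rainbow_path E c (p @ [x, y]) \<longleftrightarrow>
     rainbow_path E c (p @ [x]) \<and> {x, y} \<in> E \<and> y \<notin> set p \<and> y \<noteq> x \<and>
     c {x, y} \<notin> c ` set (path_edges (p @ [x]))"
  by (auto simp: rainbow_path_def path_edges_snoc)

lemma rainbow_path_mono: "rainbow_path E c p \<Longrightarrow> E \<subseteq> E' \<Longrightarrow> rainbow_path E' c p"
  by (auto simp: rainbow_path_def)

lemma path_edges_map_upt:
  "path_edges (map f [0..<k]) = map (\<lambda>i. f ` {i, Suc i}) [0..<k - 1]"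
  unfolding path_edges_conv_nth by (rule map_cong) auto

text \<open>The list of images of 0, ..., k - 1 encodes the embedding. With \<open>k \<ge> 2\<close>
  every vertex of the list lies on one of its edges, so the vertices belong to \<open>G\<close>
  because the edges do.\<close>

lemma has_rainbow_copy_path_graph:
  assumes "simple_graph G" "k \<ge> 2"
  shows "has_rainbow_copy (path_graph k) G c \<longleftrightarrow>
           (\<exists>p. length p = k \<and> rainbow_path (edges G) c p)"
proof
  have pg: "edges (path_graph k) = (\<lambda>i. {i, Suc i}) ` {0..<k - 1}" "verts (path_graph k) = {0..<k}"
    by (auto simp: path_graph_def)
  show "\<exists>p. length p = k \<and> rainbow_path (edges G) c p" if *: "has_rainbow_copy (path_graph k) G c"
  proof -
    obtain S f where S: "subgraph S G" "inj_on c (edges S)" "bij_betw f {0..<k} (verts S)"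
      "(\<lambda>e. f ` e) ` edges (path_graph k) = edges S"
      using * unfolding has_rainbow_copy_def graph_iso_def pg(2) by blast
    define p where "p = map f [0..<k]"
    have d: "distinct p" using S(3) by (simp add: p_def distinct_map bij_betw_def)
    have e: "set (path_edges p) = edges S"
      unfolding S(4)[symmetric] pg(1) p_def path_edges_map_upt by (simp add: image_image)
    have "distinct (map c (path_edges p))"
      unfolding distinct_map using e S(2) distinct_path_edges[OF d] by simp
    then have "rainbow_path (edges G) c p"
      using d e S(1) by (simp add: rainbow_path_def subgraph_def)
    then show ?thesis by (intro exI[of _ p]) (simp add: p_def)
  qed
  show "has_rainbow_copy (path_graph k) G c" if "\<exists>p. length p = k \<and> rainbow_path (edges G) c p"
  proof -
    obtain p where p: "length p = k" "rainbow_path (edges G) c p" using \<open>\<exists>p. _\<close> by blast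
    have pm: "p = map ((!) p) [0..<k]" using map_nth[of p] p(1) by simp
    have pe: "path_edges p = map (\<lambda>i. (!) p ` {i, Suc i}) [0..<k - 1]"
      by (subst pm) (rule path_edges_map_upt)
    have es: "set (path_edges p) \<subseteq> edges G" and d: "distinct p"
      and dc: "distinct (map c (path_edges p))"
      using p(2) by (auto simp: rainbow_path_def)
    let ?S = "(set p, set (path_edges p))"
    have "set p \<subseteq> verts G"
    proof
      fix x assume "x \<in> set p"
      then obtain i where i: "i < k" "x = p ! i" using p(1) by (auto simp: in_set_conv_nth)
      have "\<exists>j<k - 1. x \<in> {p ! j, p ! Suc j}"
      proof (cases "i < k - 1")
        case True
        then show ?thesis using i by auto
      next
        case False
        then have "Suc (k - 2) = i" "k - 2 < k - 1" using i(1) assms(2) by auto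
        then show ?thesis using i(2) by blast
      qed
      then obtain j where "j < k - 1" "x \<in> {p ! j, p ! Suc j}" by blast
      then have "{p ! j, p ! Suc j} \<in> edges G" using es unfolding pe by auto
      then show "x \<in> verts G"
        using \<open>x \<in> {p ! j, p ! Suc j}\<close> assms(1) unfolding simple_graph_def by blast
    qed
    moreover have "simple_graph ?S"
      using es assms(1) path_edges_subset[of _ p] by (auto simp: simple_graph_def)
    ultimately have "subgraph ?S G" using es by (simp add: subgraph_def)
    moreover have "graph_iso (path_graph k) ?S"
      unfolding graph_iso_def pg
    proof (intro exI[of _ "(!) p"] conjI)
      show "bij_betw ((!) p) {0..<k} (verts ?S)"
        using p(1) d by (auto intro!: bij_betw_nth)
      show "(\<lambda>e. (!) p ` e) ` (\<lambda>i. {i, Suc i}) ` {0..<k - 1} = edges ?S"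
        by (simp add: pe image_image)
    qed
    moreover have "inj_on c (edges ?S)" using dc by (simp add: distinct_map)
    ultimately show ?thesis unfolding has_rainbow_copy_def by blast
  qed
qed

section \<open>Saturation and bounds on \<open>sat_star\<close> in terms of rainbow-free
  colourings\<close>

definition rainbow_free :: "nat \<Rightarrow> 'a set set \<Rightarrow> ('a set \<Rightarrow> nat) \<Rightarrow> bool" where
  "rainbow_free k E c \<longleftrightarrow> \<not> (\<exists>p. length p = k \<and> rainbow_path E c p)"

definition proper :: "'a set set \<Rightarrow> ('a set \<Rightarrow> nat) \<Rightarrow> bool" where
  "proper E c \<longleftrightarrow> (\<forall>e\<in>E. \<forall>e'\<in>E. e \<noteq> e' \<and> e \<inter> e' \<noteq> {} \<longrightarrow> c e \<noteq> c e')"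

lemma proper_mono: "proper E c \<Longrightarrow> E' \<subseteq> E \<Longrightarrow> proper E' c"
  unfolding proper_def by blast

lemma rainbow_free_mono: "rainbow_free k E c \<Longrightarrow> E' \<subseteq> E \<Longrightarrow> rainbow_free k E' c"
  unfolding rainbow_free_def using rainbow_path_mono by blast

lemma proper_neq:
  "proper E c \<Longrightarrow> {x, y} \<in> E \<Longrightarrow> {x, z} \<in> E \<Longrightarrow> y \<noteq> z \<Longrightarrow> c {x, y} \<noteq> c {x, z}"
  unfolding proper_def by (metis disjoint_insert(1) doubleton_eq_iff insertI1)

lemma add_edge_simps [simp]: "verts (add_edge G e) = verts G" "edges (add_edge G e) = insert e (edges G)"
  by (auto simp: add_edge_def)

lemma simple_add_edge: "simple_graph G \<Longrightarrow> e \<in> non_edges G \<Longrightarrow> simple_graph (add_edge G e)"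
  by (auto simp: simple_graph_def non_edges_def)

lemma saturated_path_iff:
  assumes "simple_graph G" "k \<ge> 2"
  shows "properly_rainbow_saturated (path_graph k) G \<longleftrightarrow>
     (\<exists>c. proper (edges G) c \<and> rainbow_free k (edges G) c) \<and>
     (\<forall>e\<in>non_edges G. \<forall>c. proper (insert e (edges G)) c \<longrightarrow> \<not> rainbow_free k (insert e (edges G)) c)"
  using has_rainbow_copy_path_graph[OF assms]
    has_rainbow_copy_path_graph[OF simple_add_edge[OF assms(1)] assms(2)]
  unfolding properly_rainbow_saturated_def proper_colouring_def proper_def rainbow_free_def by auto

lemma edges_subset_pairs: "simple_graph G \<Longrightarrow> edges G \<subseteq> {e. e \<subseteq> verts G \<and> card e = 2}"
  by (auto simp: simple_graph_def)

lemma finite_edges: "simple_graph G \<Longrightarrow> finite (edges G)"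
  by (rule finite_subset[of _ "Pow (verts G)"]) (auto simp: simple_graph_def)

text \<open>The family \<open>F\<close> quantifies the colouring existentially, so a maximal member
  may be coloured quite differently from \<open>c\<close>. Maximality in \<open>F\<close> is exactly
  condition (2).\<close>

lemma saturated_extension:
  assumes G: "simple_graph (V, E)" and k: "k \<ge> 2"
    and good: "proper E c" "rainbow_free k E c"
  obtains M where "E \<subseteq> M" "simple_graph (V, M)" "properly_rainbow_saturated (path_graph k) (V, M)"
proof -
  define F where "F = {E'. E \<subseteq> E' \<and> E' \<subseteq> {e. e \<subseteq> V \<and> card e = 2} \<and>
    (\<exists>c. proper E' c \<and> rainbow_free k E' c)}"
  have fin: "finite V" using G by (simp add: simple_graph_def)
  have "finite F" by (rule finite_subset[of _ "Pow (Pow V)"]) (use fin in \<open>auto simp: F_def\<close>)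
  moreover have "E \<in> F" using good edges_subset_pairs[OF G] by (auto simp: F_def)
  ultimately obtain M where M: "M \<in> F" and max: "\<And>E'. E' \<in> F \<Longrightarrow> M \<subseteq> E' \<Longrightarrow> M = E'"
    using finite_has_maximal[of F] by auto
  have sM: "simple_graph (V, M)" using M fin by (auto simp: F_def simple_graph_def)
  have "properly_rainbow_saturated (path_graph k) (V, M)"
    unfolding saturated_path_iff[OF sM k]
  proof (intro conjI ballI allI impI notI)
    show "\<exists>c. proper (edges (V, M)) c \<and> rainbow_free k (edges (V, M)) c"
      using M by (simp add: F_def)
    fix e c assume e: "e \<in> non_edges (V, M)" and "proper (insert e (edges (V, M))) c"
      "rainbow_free k (insert e (edges (V, M))) c"
    then have "insert e M \<in> F" using M by (auto simp: F_def non_edges_def)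
    then have "M = insert e M" using max by blast
    then show False using e by (auto simp: non_edges_def)
  qed
  with that sM M show thesis by (auto simp: F_def)
qed

text \<open>The set \<open>X\<close> collects the pairs about which nothing is claimed. A good
  colouring of a saturated extension \<open>M\<close> restricts to each \<open>insert e E\<close>
  with \<open>e\<close> in \<open>M\<close>, so \<open>M\<close> can add only pairs from
  \<open>X\<close>.\<close>

lemma sat_star_path_le:
  fixes V :: "nat set"
  assumes G: "simple_graph (V, E)" "card V = n" and k: "k \<ge> 2"
    and good: "proper E c" "rainbow_free k E c"
    and X: "finite X"
    and forced: "\<And>e c. e \<in> non_edges (V, E) - X \<Longrightarrow> proper (insert e E) c \<Longrightarrow>
      \<not> rainbow_free k (insert e E) c"
  shows "sat_star n (path_graph k) \<le> card E + card X"
proof -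
  obtain M where M: "E \<subseteq> M" "simple_graph (V, M)"
    "properly_rainbow_saturated (path_graph k) (V, M)"
    using saturated_extension[OF G(1) k good] .
  have "sat_star n (path_graph k) \<le> card M"
    unfolding sat_star_def by (rule cInf_lower) (use M G(2) in force)+
  also have "M \<subseteq> E \<union> X"
  proof (rule ccontr)
    assume "\<not> M \<subseteq> E \<union> X"
    then obtain e where e: "e \<in> M" "e \<notin> E" "e \<notin> X" by blast
    obtain c where "proper M c" "rainbow_free k M c"
      using M(3) unfolding saturated_path_iff[OF M(2) k] by auto
    moreover have "insert e E \<subseteq> M" using e M by auto
    moreover have "e \<in> non_edges (V, E) - X"
      using e M(2) by (auto simp: simple_graph_def non_edges_def)
    ultimately show False using forced proper_mono rainbow_free_mono by metis
  qed
  then have "card M \<le> card (E \<union> X)"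
    using finite_edges[OF G(1)] X by (intro card_mono) auto
  also have "\<dots> \<le> card E + card X" by (rule card_Un_le)
  finally show ?thesis .
qed

text \<open>Since \<open>Inf {} = 0\<close>, a lower bound needs the existence of a saturated graph.\<close>

lemma sat_star_path_ge:
  assumes k: "k \<ge> 2"
    and lower: "\<And>G :: nat sgraph. simple_graph G \<Longrightarrow> card (verts G) = n \<Longrightarrow>
      properly_rainbow_saturated (path_graph k) G \<Longrightarrow> m \<le> card (edges G)"
  shows "m \<le> sat_star n (path_graph k)"
proof -
  \<comment> \<open>A path on at least two vertices has an edge, so the edgeless graph is
    rainbow-free and can be extended to a saturated one.\<close>
  have "path_edges p \<noteq> []" if "length p = k" for p :: "nat list"
    using that k length_path_edges[of p] by auto
  then have free: "rainbow_free k {} (\<lambda>_ :: nat set. 0)"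
    by (auto simp: rainbow_free_def rainbow_path_def)
  have empty: "simple_graph ({..<n}, {})" "proper {} (\<lambda>_ :: nat set. 0)"
    by (auto simp: simple_graph_def proper_def)
  obtain M where "simple_graph ({..<n}, M)" "properly_rainbow_saturated (path_graph k) ({..<n}, M)"
    using saturated_extension[OF empty(1) k empty(2) free] .
  then have "{card (edges G) | G :: nat sgraph. simple_graph G \<and> card (verts G) = n \<and>
      properly_rainbow_saturated (path_graph k) G} \<noteq> {}"
    by (auto intro!: exI[of _ "{..<n}"] exI[of _ M])
  then show ?thesis unfolding sat_star_def by (rule cInf_greatest) (use lower in auto)
qed

section \<open>Good ends and the lower bound\<close>

definition nbrs :: "'a set set \<Rightarrow> 'a \<Rightarrow> 'a set" where
  "nbrs E v = {w. {v, w} \<in> E}"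

text \<open>The witness \<open>x2\<close> need not be adjacent to \<open>x1\<close>; this covers
  stars and single edges, where \<open>x1\<close> has no non-leaf neighbour to exempt.\<close>

definition good_end :: "'a set set \<Rightarrow> 'a \<Rightarrow> bool" where
  "good_end E x \<longleftrightarrow> nbrs E x = {} \<or>
     (\<exists>x1. nbrs E x = {x1} \<and> (\<exists>x2. \<forall>z\<in>nbrs E x1. z \<noteq> x2 \<longrightarrow> nbrs E z = {x1}))"

lemma nbrs_sym: "w \<in> nbrs E v \<longleftrightarrow> v \<in> nbrs E w"
  by (simp add: nbrs_def insert_commute)

lemma nbrs_subset: "simple_graph (V, E) \<Longrightarrow> nbrs E v \<subseteq> V"
  by (auto simp: nbrs_def simple_graph_def)

lemma nbrs_irrefl: "simple_graph (V, E) \<Longrightarrow> v \<notin> nbrs E v"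
  by (auto simp: nbrs_def simple_graph_def)

section \<open>Counting edges in the absence of good ends\<close>

text \<open>Double counting of incidences inside \<open>K\<close>: each vertex contributes at least
  2, each edge exactly 2.\<close>

lemma card_edges_ge_min_degree2:
  assumes G: "simple_graph (V, E)" and K: "K \<subseteq> V"
    and deg: "\<And>v. v \<in> K \<Longrightarrow> 2 \<le> card (nbrs E v \<inter> K)"
  shows "card K \<le> card {e \<in> E. e \<subseteq> K}"
proof -
  let ?F = "{e \<in> E. e \<subseteq> K}"
  have finV: "finite V" using G by (simp add: simple_graph_def)
  have finK: "finite K" using K finV by (rule finite_subset)
  have finF: "finite ?F" using finite_edges[OF G] by simp
  have "2 * card K = (\<Sum>v\<in>K. 2)" by simp
  also have "\<dots> \<le> (\<Sum>v\<in>K. card {e \<in> ?F. v \<in> e})"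
  proof (rule sum_mono)
    fix v assume v: "v \<in> K"
    have "card ((\<lambda>w. {v, w}) ` (nbrs E v \<inter> K)) \<le> card {e \<in> ?F. v \<in> e}"
      by (rule card_mono[OF finite_subset[OF _ finF]]) (use v in \<open>auto simp: nbrs_def\<close>)
    moreover have "inj_on (\<lambda>w. {v, w}) (nbrs E v \<inter> K)"
      by (auto simp: inj_on_def doubleton_eq_iff)
    ultimately show "2 \<le> card {e \<in> ?F. v \<in> e}" using deg[OF v] by (simp add: card_image)
  qed
  also have "\<dots> = 2 * card ?F"
  proof (rule sum_multicount)
    show "\<forall>e\<in>?F. card {v \<in> K. v \<in> e} = 2"
    proof
      fix e assume e: "e \<in> ?F"
      then have "{v \<in> K. v \<in> e} = e" by auto
      then show "card {v \<in> K. v \<in> e} = 2" using e G by (simp add: simple_graph_def)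
    qed
  qed (use finK finF in auto)
  finally show ?thesis by simp
qed

text \<open>Let \<open>L\<close> be the leaves and \<open>K\<close> the rest. The neighbour of a
  leaf has two non-leaf neighbours, since otherwise the leaf would be a good end. A vertex of
  \<open>K\<close> without leaf neighbours keeps all its neighbours in \<open>K\<close>, at least
  two of them. So \<open>K\<close> spans at least \<open>card K\<close> edges, and each leaf adds
  its own pendant edge.\<close>

lemma card_edges_ge_no_good_end:
  assumes G: "simple_graph (V, E)" and W: "W \<subseteq> V"
    and closed: "\<And>v. v \<in> W \<Longrightarrow> nbrs E v \<subseteq> W"
    and bad: "\<And>v. v \<in> W \<Longrightarrow> \<not> good_end E v"
  shows "card W \<le> card {e \<in> E. e \<subseteq> W}"
proof -
  define L where "L = {v \<in> W. \<exists>u. nbrs E v = {u}}"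
  define K where "K = W - L"
  have finV: "finite V" using G by (simp add: simple_graph_def)
  have finW: "finite W" using W finV by (rule finite_subset)
  have fin_nbrs: "finite (nbrs E v)" for v
    using nbrs_subset[OF G] finV by (rule finite_subset)
  have nbr_leaf: "u \<in> K" and two_nonleaves: "2 \<le> card (nbrs E u \<inter> K)"
    if x: "x \<in> L" "nbrs E x = {u}" for x u
  proof -
    have "\<not> good_end E x" using bad x by (simp add: L_def)
    \<comment> \<open>The vertex \<open>w\<close> instantiates \<open>x2\<close> in the negated
      \<open>good_end\<close>; a second use with \<open>w\<close> set to the vertex found before
      yields two different non-leaf neighbours.\<close>
    then have ex: "\<exists>z\<in>nbrs E u. z \<noteq> w \<and> nbrs E z \<noteq> {u}" for w
      using x by (auto simp: good_end_def)
    have uW: "u \<in> W" using closed[of x] x by (auto simp: L_def)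
    have xu: "x \<in> nbrs E u" using nbrs_sym[of x E u] x by simp
    show "u \<in> K"
    proof (rule ccontr)
      assume "u \<notin> K"
      then have "nbrs E u = {x}" using uW xu by (auto simp: K_def L_def)
      then show False using ex x by auto
    qed
    have inK: "z \<in> K" if "z \<in> nbrs E u" "nbrs E z \<noteq> {u}" for z
      using that nbrs_sym[of z E u] closed[OF uW] by (auto simp: K_def L_def)
    obtain z1 where z1: "z1 \<in> nbrs E u" "nbrs E z1 \<noteq> {u}" using ex by blast
    obtain z2 where z2: "z2 \<in> nbrs E u" "nbrs E z2 \<noteq> {u}" "z2 \<noteq> z1" using ex by blast
    have "card {z1, z2} \<le> card (nbrs E u \<inter> K)"
      using z1 z2 inK fin_nbrs by (intro card_mono) auto
    then show "2 \<le> card (nbrs E u \<inter> K)" using z2 by simp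
  qed
  have deg: "2 \<le> card (nbrs E v \<inter> K)" if v: "v \<in> K" for v
  proof (cases "\<exists>x\<in>L. nbrs E x = {v}")
    case True
    then show ?thesis using two_nonleaves by blast
  next
    case False
    have vW: "v \<in> W" using v by (simp add: K_def)
    have "nbrs E v \<subseteq> K"
    proof
      fix z assume z: "z \<in> nbrs E v"
      then have "v \<in> nbrs E z" by (simp add: nbrs_sym)
      then show "z \<in> K" using False z closed[OF vW] by (auto simp: K_def L_def)
    qed
    moreover have "card (nbrs E v) \<noteq> 0"
      using bad[OF vW] fin_nbrs by (auto simp: good_end_def)
    moreover have "card (nbrs E v) \<noteq> 1"
      using v by (auto simp: K_def L_def card_1_singleton_iff)
    ultimately show ?thesis by (simp add: Int_absorb2)
  qed
  \<comment> \<open>On a leaf this is its pendant edge. It determines the leaf, because the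
    neighbour of a leaf is not a leaf here.\<close>
  let ?P = "\<lambda>x. insert x (nbrs E x)"
  have inj: "inj_on ?P L"
  proof (rule inj_onI)
    fix x y assume xy: "x \<in> L" "y \<in> L" "?P x = ?P y"
    then obtain u w where "nbrs E x = {u}" "nbrs E y = {w}" by (auto simp: L_def)
    moreover have "u \<notin> L" using nbr_leaf xy(1) calculation by (auto simp: K_def)
    ultimately show "x = y" using xy by (metis insertE insertI1 singletonD)
  qed
  have leaf_edges: "?P ` L \<subseteq> {e \<in> E. e \<subseteq> W} - {e \<in> E. e \<subseteq> K}"
  proof
    fix e assume "e \<in> ?P ` L"
    then obtain x u where x: "x \<in> L" "nbrs E x = {u}" "e = {x, u}" by (auto simp: L_def)
    then have "e \<in> E" by (auto simp: nbrs_def)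
    then show "e \<in> {e \<in> E. e \<subseteq> W} - {e \<in> E. e \<subseteq> K}"
      using x closed[of x] by (auto simp: K_def L_def)
  qed
  have finE: "finite {e \<in> E. e \<subseteq> W}" using finite_edges[OF G] by simp
  have LW: "L \<subseteq> W" by (auto simp: L_def)
  then have finL: "finite L" using finW by (rule finite_subset)
  have "card W = card K + card L"
    using card_Diff_subset[OF finL LW] card_mono[OF finW LW] by (simp add: K_def)
  also have "\<dots> \<le> card {e \<in> E. e \<subseteq> K} + card (?P ` L)"
    using card_edges_ge_min_degree2[OF G _ deg] W card_image[OF inj] by (auto simp: K_def)
  also have "\<dots> = card ({e \<in> E. e \<subseteq> K} \<union> ?P ` L)"
    using leaf_edges finite_edges[OF G] finL
    by (intro card_Un_disjoint[symmetric]) auto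
  also have "\<dots> \<le> card {e \<in> E. e \<subseteq> W}"
    using leaf_edges finE by (intro card_mono) (auto simp: K_def)
  finally show ?thesis .
qed

section \<open>Components and the paths inside them\<close>

definition component :: "'a set set \<Rightarrow> 'a \<Rightarrow> 'a set" where
  "component E x = {y. (x, y) \<in> {(u, v). {u, v} \<in> E}\<^sup>*}"

lemma component_refl: "x \<in> component E x"
  by (simp add: component_def)

lemma component_step: "u \<in> component E x \<Longrightarrow> {u, v} \<in> E \<Longrightarrow> v \<in> component E x"
  by (simp add: component_def rtrancl.rtrancl_into_rtrancl)

lemma component_edge: "{u, v} \<in> E \<Longrightarrow> u \<in> component E x \<longleftrightarrow> v \<in> component E x"
  using component_step[of u E x v] component_step[of v E x u] by (auto simp: insert_commute)

lemma component_subset: "simple_graph (V, E) \<Longrightarrow> x \<in> V \<Longrightarrow> component E x \<subseteq> V"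
proof
  fix y assume "simple_graph (V, E)" "x \<in> V" "y \<in> component E x"
  then have "(x, y) \<in> {(u, v). {u, v} \<in> E}\<^sup>*" by (simp add: component_def)
  then show "y \<in> V"
    by induction (use \<open>x \<in> V\<close> \<open>simple_graph (V, E)\<close> in \<open>auto simp: simple_graph_def\<close>)
qed

lemma component_frontier:
  assumes "x \<in> S" "S \<subset> component E x"
  obtains u v where "u \<in> S" "v \<in> component E x - S" "{u, v} \<in> E"
proof (rule ccontr)
  assume "\<not> thesis"
  then have no: "\<And>u v. u \<in> S \<Longrightarrow> v \<in> component E x \<Longrightarrow> {u, v} \<in> E \<Longrightarrow> v \<in> S"
    using that by blast
  have "y \<in> S" if "(x, y) \<in> {(u, v). {u, v} \<in> E}\<^sup>*" for y
    using that
  proof induction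
    case (step y z)
    then have "z \<in> component E x" unfolding component_def
      by (auto intro: rtrancl_into_rtrancl)
    then show ?case using no step by blast
  qed (use assms in simp)
  then have "component E x \<subseteq> S" by (auto simp: component_def)
  then show False using assms by blast
qed

text \<open>A vertex set grown from \<open>x\<close> across frontier edges gains a new edge with
  each new vertex; this replaces a spanning tree.\<close>

lemma card_edges_component:
  assumes G: "simple_graph (V, E)" and x: "x \<in> V"
  shows "card (component E x) \<le> Suc (card {e \<in> E. e \<subseteq> component E x})"
proof -
  let ?C = "component E x"
  have finC: "finite ?C"
    using component_subset[OF G x] G by (auto simp: simple_graph_def intro: finite_subset)
  have "\<exists>S. x \<in> S \<and> S \<subseteq> ?C \<and> card S = Suc m \<and> m \<le> card {e \<in> E. e \<subseteq> S}"
    if "Suc m \<le> card ?C" for m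
    using that
  proof (induction m)
    case 0
    show ?case using component_refl[of x E] by (intro exI[of _ "{x}"]) auto
  next
    case (Suc m)
    then obtain S where S: "x \<in> S" "S \<subseteq> ?C" "card S = Suc m" "m \<le> card {e \<in> E. e \<subseteq> S}"
      by auto
    then have "S \<subset> ?C" using Suc.prems by auto
    then obtain u v where uv: "u \<in> S" "v \<in> ?C - S" "{u, v} \<in> E"
      using component_frontier[OF S(1)] by metis
    have finS: "finite S" using S(2) finC by (rule finite_subset)
    have fin: "finite {e \<in> E. e \<subseteq> insert v S}" using finite_edges[OF G] by simp
    have "Suc m \<le> Suc (card {e \<in> E. e \<subseteq> S})" using S by simp
    also have "\<dots> = card (insert {u, v} {e \<in> E. e \<subseteq> S})"
      using uv finite_edges[OF G] by (subst card_insert_disjoint) auto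
    also have "\<dots> \<le> card {e \<in> E. e \<subseteq> insert v S}"
      using fin uv by (intro card_mono) auto
    finally show ?case using S uv finS by (intro exI[of _ "insert v S"]) auto
  qed
  moreover obtain m where m: "card ?C = Suc m"
    using finC component_refl[of x E] by (metis card_gt_0_iff empty_iff gr0_conv_Suc)
  ultimately obtain S where S: "S \<subseteq> ?C" "card S = Suc m" "m \<le> card {e \<in> E. e \<subseteq> S}" by auto
  then have "S = ?C" using finC m by (simp add: card_subset_eq)
  then show ?thesis using S m by simp
qed

text \<open>A path lies entirely inside or entirely outside a component, so recolouring one
  component affects all its edges alike.\<close>

lemma path_in_component:
  assumes "set (path_edges p) \<subseteq> E" "e \<in> set (path_edges p)" "f \<in> set (path_edges p)"
    "e \<subseteq> component E x"
  shows "f \<subseteq> component E x"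
proof -
  have "(\<forall>v\<in>set p. v \<in> component E x) \<or> (\<forall>v\<in>set p. v \<notin> component E x)"
    using assms(1)
  proof (induction p rule: path_edges.induct)
    case (1 a b p)
    then show ?case using component_edge[of a b E x] by auto
  qed auto
  moreover have "e \<subseteq> set p" "f \<subseteq> set p" using assms(2,3) path_edges_subset by blast+
  moreover have "{} \<notin> set (path_edges p)" by (induction p rule: path_edges.induct) auto
  then have "e \<noteq> {}" using assms(2) by metis
  ultimately show ?thesis using assms(4) by blast
qed

section \<open>Joining two good ends\<close>

text \<open>A uniform description of isolated and pendant good ends: \<open>a\<close> is the colour
  at \<open>x\<close>, and \<open>g\<close> the colour of the only edge through which a path coming
  from \<open>x\<close> can get past the star around \<open>x1\<close>. For an isolated vertex both
  conditions are vacuous.\<close>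

lemma good_end_colours:
  assumes "proper E c" "good_end E x" "x \<notin> nbrs E x"
  obtains a g :: nat where "a \<noteq> g" "\<And>w. w \<in> nbrs E x \<Longrightarrow> c {x, w} = a"
    "\<And>x1 z. x1 \<in> nbrs E x \<Longrightarrow> z \<in> nbrs E x1 \<Longrightarrow> z \<noteq> x \<Longrightarrow> c {x1, z} = g \<or> nbrs E z = {x1}"
proof (cases "nbrs E x = {}")
  case True
  then show ?thesis using that[of 0 1] by auto
next
  case False
  then obtain x1 x2 where x: "nbrs E x = {x1}" "\<And>z. z \<in> nbrs E x1 \<Longrightarrow> z \<noteq> x2 \<Longrightarrow> nbrs E z = {x1}"
    using assms(2) unfolding good_end_def by metis
  \<comment> \<open>If \<open>x1\<close> has no exempted neighbour besides \<open>x\<close>, any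
    value different from the colour of \<open>{x, x1}\<close> serves, here its successor.\<close>
  define g where "g = (if x2 \<in> nbrs E x1 \<and> x2 \<noteq> x then c {x1, x2} else Suc (c {x, x1}))"
  have x1: "x \<in> nbrs E x1" using x(1) nbrs_sym[of x1 E x] by simp
  have "c {x, x1} \<noteq> g"
    using proper_neq[OF assms(1), of x1 x x2] x1
    by (auto simp: g_def nbrs_def insert_commute[of x x1])
  moreover have "c {x1, z} = g \<or> nbrs E z = {x1}" if "z \<in> nbrs E x1" "z \<noteq> x" for z
    using that x(2)[of z] by (cases "z = x2") (simp_all add: g_def)
  ultimately show ?thesis using that[of "c {x, x1}" g] x(1) by (metis singletonD)
qed

text \<open>Properness and being rainbow depend only on which colours coincide, so an injective
  recolouring is enough. The values \<open>Suc (a + g + n)\<close> exceed both \<open>a\<close> and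
  \<open>g\<close> and therefore never collide with them.\<close>

lemma inj_two_points:
  fixes a g a' g' :: nat
  assumes "a \<noteq> g" "a' \<noteq> g'"
  obtains \<pi> :: "nat \<Rightarrow> nat" where "inj \<pi>" "\<pi> a' = a" "\<pi> g' = g"
proof
  let ?\<pi> = "\<lambda>n. if n = a' then a else if n = g' then g else Suc (a + g + n)"
  show "inj ?\<pi>" using assms(1) by (auto simp: inj_on_def)
qed (use assms(2) in auto)

lemma edge_at:
  assumes "simple_graph (V, E)" "e \<in> E" "v \<in> e"
  obtains w where "w \<in> nbrs E v" "e = {v, w}"
proof -
  have "card e = 2" using assms by (auto simp: simple_graph_def)
  then obtain a b where "e = {a, b}" by (auto simp: card_2_iff)
  then have "e = {v, a} \<or> e = {v, b}" using assms(3) by auto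
  then show ?thesis using that assms(2) by (auto simp: nbrs_def)
qed

text \<open>Suppose the path runs y, x, x1, z, w. The edge \<open>{x1, z}\<close> cannot repeat the
  colour of \<open>{x, y}\<close>, so \<open>z\<close> is a leaf at \<open>x1\<close> and has no
  further neighbour \<open>w\<close>.\<close>

lemma rainbow_path_end_short:
  assumes p: "rainbow_path (insert {x, y} E) c (y # x # v)"
    and g: "\<And>x1 z. x1 \<in> nbrs E x \<Longrightarrow> z \<in> nbrs E x1 \<Longrightarrow> z \<noteq> x \<Longrightarrow>
      c {x1, z} = c {x, y} \<or> nbrs E z = {x1}"
  shows "length v \<le> 2"
proof (rule ccontr)
  assume "\<not> length v \<le> 2"
  then obtain x1 z w v' where v: "v = x1 # z # w # v'"
    by (auto simp: not_le numeral_2_eq_2 Suc_less_eq2 length_Suc_conv neq_Nil_conv)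
  have "{x, x1} \<in> insert {x, y} E" "{x1, z} \<in> insert {x, y} E" "{z, w} \<in> insert {x, y} E"
    "distinct [y, x, x1, z, w]" "c {x1, z} \<noteq> c {x, y}"
    using p by (auto simp: v rainbow_path_def insert_commute)
  then have "x1 \<in> nbrs E x" "z \<in> nbrs E x1" "w \<in> nbrs E z" "z \<noteq> x" "w \<noteq> x1"
    "c {x1, z} \<noteq> c {x, y}"
    by (auto simp: nbrs_def doubleton_eq_iff)
  then show False using g by blast
qed

text \<open>Two good ends can be joined: permuting the colours of one component, the pendant edges at
  \<open>x\<close> and \<open>y\<close> get the same colour \<open>a\<close>, and the new edge gets the colour \<open>g\<close> of the only edges
  through which a path can leave the stars around the neighbours of \<open>x\<close> and \<open>y\<close>.\<close>

lemma join_good_ends: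
  assumes G: "simple_graph (V, E)" and k: "k \<ge> 5"
    and c: "proper E c" "rainbow_free k E c"
    and x: "good_end E x" and y: "good_end E y" "y \<notin> component E x"
  obtains c' where "proper (insert {x, y} E) c'" "rainbow_free k (insert {x, y} E) c'"
proof -
  let ?C = "component E x"
  let ?E = "insert {x, y} E"
  obtain a g where ag: "a \<noteq> g" "\<And>w. w \<in> nbrs E x \<Longrightarrow> c {x, w} = a"
    "\<And>x1 z. x1 \<in> nbrs E x \<Longrightarrow> z \<in> nbrs E x1 \<Longrightarrow> z \<noteq> x \<Longrightarrow> c {x1, z} = g \<or> nbrs E z = {x1}"
    using good_end_colours[OF c(1) x nbrs_irrefl[OF G]] by blast
  obtain a' g' where ag': "a' \<noteq> g'" "\<And>w. w \<in> nbrs E y \<Longrightarrow> c {y, w} = a'"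
    "\<And>y1 z. y1 \<in> nbrs E y \<Longrightarrow> z \<in> nbrs E y1 \<Longrightarrow> z \<noteq> y \<Longrightarrow> c {y1, z} = g' \<or> nbrs E z = {y1}"
    using good_end_colours[OF c(1) y(1) nbrs_irrefl[OF G]] by blast
  obtain \<pi> :: "nat \<Rightarrow> nat" where pi: "inj \<pi>" "\<pi> a' = a" "\<pi> g' = g"
    using inj_two_points[OF ag(1) ag'(1)] .
  define c' where "c' e = (if e = {x, y} then g else if e \<subseteq> ?C then c e else \<pi> (c e))" for e
  have xC: "x \<in> ?C" by (rule component_refl)
  have xyE: "{x, y} \<notin> E" using component_step[OF xC] y(2) by blast
  have in_C: "c' {u, v} = c {u, v}" if "{u, v} \<in> E" "u \<in> ?C" for u v
    using that component_step[OF that(2,1)] xyE by (auto simp: c'_def)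
  have out_C: "c' {u, v} = \<pi> (c {u, v})" if "{u, v} \<in> E" "u \<notin> ?C" for u v
    using that xyE by (auto simp: c'_def)
  have c'_xy: "c' {x, y} = g" by (simp add: c'_def)
  have at_x: "c' {x, w} = a" if "w \<in> nbrs E x" for w
    using in_C[of x w] xC ag(2)[OF that] that by (simp add: nbrs_def)
  have at_y: "c' {y, w} = a" if "w \<in> nbrs E y" for w
    using out_C[of y w] y(2) ag'(2)[OF that] that pi by (simp add: nbrs_def)
  have near_x: "c' {x1, z} = g \<or> nbrs E z = {x1}"
    if "x1 \<in> nbrs E x" "z \<in> nbrs E x1" "z \<noteq> x" for x1 z
    using in_C[of x1 z] ag(3)[OF that] that component_step[OF xC, of x1] by (auto simp: nbrs_def)
  have near_y: "c' {y1, z} = g \<or> nbrs E z = {y1}"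
    if "y1 \<in> nbrs E y" "z \<in> nbrs E y1" "z \<noteq> y" for y1 z
    using out_C[of y1 z] ag'(3)[OF that] that component_edge[of y y1 E x] y(2) pi
    by (auto simp: nbrs_def)
  have same_part: "(c' e = c e \<and> c' f = c f) \<or> (c' e = \<pi> (c e) \<and> c' f = \<pi> (c f))"
    if ef: "e \<in> E" "f \<in> E" "e \<subseteq> ?C \<longleftrightarrow> f \<subseteq> ?C" for e f
    using ef xyE by (auto simp: c'_def)
  have "proper ?E c'"
    unfolding proper_def
  proof (intro ballI impI)
    \<comment> \<open>Every old edge at \<open>x\<close> or \<open>y\<close> now has colour
      \<open>a\<close>, which differs from the colour \<open>g\<close> of the new edge.\<close>
    have new: "c' e \<noteq> g" if e: "e \<in> E" "e \<inter> {x, y} \<noteq> {}" for e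
    proof -
      have "(\<exists>w\<in>nbrs E x. e = {x, w}) \<or> (\<exists>w\<in>nbrs E y. e = {y, w})"
        using e edge_at[OF G e(1), of x] edge_at[OF G e(1), of y] by blast
      then show ?thesis using at_x at_y ag(1) by auto
    qed
    fix e f assume ef: "e \<in> ?E" "f \<in> ?E" "e \<noteq> f \<and> e \<inter> f \<noteq> {}"
    show "c' e \<noteq> c' f"
    proof (cases "e \<in> E \<and> f \<in> E")
      case True
      obtain u where u: "u \<in> e" "u \<in> f" using ef(3) by blast
      obtain v where v: "e = {u, v}" using edge_at[OF G _ u(1)] True by blast
      obtain w where w: "f = {u, w}" using edge_at[OF G _ u(2)] True by blast
      have "c e \<noteq> c f" using c(1) True ef(3) by (auto simp: proper_def)
      moreover have "e \<subseteq> ?C \<longleftrightarrow> f \<subseteq> ?C"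
        using component_edge[of u v E x] component_edge[of u w E x] True v w by auto
      ultimately show ?thesis using same_part[of e f] True pi(1) by (metis injD)
    next
      case False
      then have "(e = {x, y} \<and> f \<in> E) \<or> (f = {x, y} \<and> e \<in> E)" using ef by auto
      then show ?thesis using new[of e] new[of f] ef(3) c'_xy by auto
    qed
  qed
  moreover have "rainbow_free k ?E c'"
    unfolding rainbow_free_def
  proof
    assume "\<exists>p. length p = k \<and> rainbow_path ?E c' p"
    then obtain p where p: "length p = k" "rainbow_path ?E c' p" by blast
    have through: False if q: "rainbow_path ?E c' (u @ x # y # v)" "length (u @ x # y # v) = k" for u v
    proof -
      have r1: "rainbow_path ?E c' (x # y # v)" using q(1) by (rule rainbow_path_append2)
      then have "length v \<le> 2"
        using rainbow_path_end_short[of y x E c' v] near_y c'_xy insert_commute[of x y "{}"] by simp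
      moreover have "rainbow_path ?E c' (y # x # rev u)"
        using q(1) rainbow_path_rev[of ?E c' "u @ x # y # v"]
          rainbow_path_append2[of ?E c' "rev v" "y # x # rev u"] by simp
      then have "length (rev u) \<le> 2"
        by (rule rainbow_path_end_short) (use near_x c'_xy in simp)
      \<comment> \<open>Each side has at most two vertices beyond the new edge and
        \<open>k \<ge> 5\<close>, so neither side is empty. The path then uses an old edge at
        \<open>x\<close> and an old edge at \<open>y\<close>, both of colour
        \<open>a\<close>.\<close>
      ultimately have "u \<noteq> []" "v \<noteq> []" using q(2) k by auto
      then obtain u' x1 y1 v' where uv: "u = u' @ [x1]" "v = y1 # v'"
        by (metis neq_Nil_conv rev_exhaust)
      have r2: "rainbow_path ?E c' ([x1, x, y, y1] @ v')"
        using rainbow_path_append2[of ?E c' u' "[x1, x, y, y1] @ v'"] q(1) uv by simp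
      have "rainbow_path ?E c' [x1, x, y, y1]" by (rule rainbow_path_append1[OF r2])
      then have "distinct [x1, x, y, y1]" "{x, x1} \<in> ?E" "{y, y1} \<in> ?E" "c' {x, x1} \<noteq> c' {y, y1}"
        by (auto simp: rainbow_path_def insert_commute)
      then show False using at_x[of x1] at_y[of y1] by (auto simp: nbrs_def doubleton_eq_iff)
    qed
    show False
    proof (cases "{x, y} \<in> set (path_edges p)")
      case True
      then obtain u v where "p = u @ x # y # v \<or> p = u @ y # x # v"
        using path_edges_split by metis
      then show False
      proof
        assume "p = u @ y # x # v"
        then have "rev p = rev v @ x # y # rev u" by simp
        then show False using through[of "rev v" "rev u"] p rainbow_path_rev[of ?E c' p]
          by (metis length_rev)
      qed (use through p in blast)
    next
      case False
      \<comment> \<open>A path avoiding the new edge stays inside or outside \<open>?C\<close>,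
        where \<open>c'\<close> is \<open>c\<close> or \<open>c\<close> followed by the injection
        \<open>\<pi>\<close>; hence it was rainbow under \<open>c\<close> already.\<close>
      then have pE: "set (path_edges p) \<subseteq> E" using p(2) by (auto simp: rainbow_path_def)
      have "c e \<noteq> c f" if ef: "e \<in> set (path_edges p)" "f \<in> set (path_edges p)" "c' e \<noteq> c' f" for e f
        using same_part[of e f] path_in_component[OF pE ef(1,2), of x]
          path_in_component[OF pE ef(2,1), of x] pE ef by (metis subsetD)
      then have "rainbow_path E c p"
        using p(2) pE unfolding rainbow_path_def distinct_map inj_on_def by metis
      then show False using c(2) p(1) by (auto simp: rainbow_free_def)
    qed
  qed
  ultimately show thesis by (rule that)
qed

text \<open>The loss of 1 comes from a single component: connectedness gives the component of a good
  end all but one of the edges wanted, and the remaining vertices contain no good end.\<close>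

lemma saturated_path_edges_ge:
  assumes G: "simple_graph (V, E)" and k: "k \<ge> 5"
    and sat: "properly_rainbow_saturated (path_graph k) (V, E)"
  shows "card V - 1 \<le> card E"
proof (cases "\<exists>x\<in>V. good_end E x")
  case False
  have "{e \<in> E. e \<subseteq> V} = E" using G by (auto simp: simple_graph_def)
  then show ?thesis
    using card_edges_ge_no_good_end[OF G order_refl nbrs_subset[OF G]] False by simp
next
  case True
  then obtain x where x: "x \<in> V" "good_end E x" by blast
  let ?C = "component E x"
  have fin: "finite V" "finite E" using G finite_edges[OF G] by (auto simp: simple_graph_def)
  have CV: "?C \<subseteq> V" using component_subset[OF G x(1)] .
  have k2: "k \<ge> 2" using k by simp
  obtain c where c: "proper E c" "rainbow_free k E c"
    using sat unfolding saturated_path_iff[OF G k2] by auto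
  have bad: "\<not> good_end E y" if y: "y \<in> V - ?C" for y
  proof
    assume "good_end E y"
    then obtain c' where c': "proper (insert {x, y} E) c'" "rainbow_free k (insert {x, y} E) c'"
      using join_good_ends[OF G k c x(2)] y by blast
    have "{x, y} \<notin> E" "x \<noteq> y"
      using y component_refl[of x E] component_step[OF component_refl[of x E], of y] by auto
    then have "{x, y} \<in> non_edges (V, E)" using x y by (auto simp: non_edges_def)
    then show False using sat c' unfolding saturated_path_iff[OF G k2] by auto
  qed
  have closed: "nbrs E v \<subseteq> V - ?C" if "v \<in> V - ?C" for v
    using that nbrs_subset[OF G, of v] component_edge[of v _ E x] by (auto simp: nbrs_def)
  have "card V = card ?C + card (V - ?C)"
    using card_Un_disjoint[of ?C "V - ?C"] CV fin finite_subset[OF CV] by (simp add: Un_absorb1)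
  moreover have "card (V - ?C) \<le> card {e \<in> E. e \<subseteq> V - ?C}"
    using card_edges_ge_no_good_end[OF G _ closed bad] by blast
  moreover have "card ?C \<le> Suc (card {e \<in> E. e \<subseteq> ?C})" by (rule card_edges_component[OF G x(1)])
  moreover have "card {e \<in> E. e \<subseteq> ?C} + card {e \<in> E. e \<subseteq> V - ?C} \<le> card E"
  proof -
    have "e = {}" if "e \<subseteq> ?C" "e \<subseteq> V - ?C" for e using that by blast
    moreover have "{} \<notin> E" using G by (auto simp: simple_graph_def)
    ultimately have "{e \<in> E. e \<subseteq> ?C} \<inter> {e \<in> E. e \<subseteq> V - ?C} = {}" by blast
    then have "card {e \<in> E. e \<subseteq> ?C} + card {e \<in> E. e \<subseteq> V - ?C} =
        card ({e \<in> E. e \<subseteq> ?C} \<union> {e \<in> E. e \<subseteq> V - ?C})"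
      using fin by (intro card_Un_disjoint[symmetric]) auto
    also have "\<dots> \<le> card E" using fin by (intro card_mono) auto
    finally show ?thesis .
  qed
  ultimately show ?thesis by linarith
qed

section \<open>Paths on at least seven vertices\<close>

lemma path_interior_not_leaf:
  assumes "distinct p" "set (path_edges p) \<subseteq> E" "0 < i" "Suc i < length p"
    and leaf: "\<And>y. {p ! i, y} \<in> E \<Longrightarrow> y = w"
  shows False
proof -
  have "{p ! j, p ! Suc j} \<in> E" if "Suc j < length p" for j
    using assms(2) that by (auto simp: path_edges_conv_nth)
  from this[of "i - 1"] this[of i] have "p ! (i - 1) = w" "p ! Suc i = w"
    using leaf assms(3,4) by (auto simp: insert_commute)
  moreover have "i - 1 < length p" "i - 1 \<noteq> Suc i" using assms(3,4) by auto
  ultimately show False using assms(1,4) nth_eq_iff_index_eq by metis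
qed

lemma card_neighbours_coloured_le:
  assumes "proper E c" "\<And>w. w \<in> N \<Longrightarrow> {v, w} \<in> E" "finite F"
  shows "card {w \<in> N. c {v, w} \<in> F} \<le> card F"
proof (rule card_inj_on_le[of "\<lambda>w. c {v, w}"])
  show "inj_on (\<lambda>w. c {v, w}) {w \<in> N. c {v, w} \<in> F}"
    using proper_neq[OF assms(1)] assms(2) by (fastforce simp: inj_on_def)
qed (use assms(3) in auto)

text \<open>The last edge of the path costs nothing: it shares \<open>v\<close> with every edge considered.\<close>

lemma card_blocked_le:
  assumes c: "proper E c" and p: "rainbow_path E c (q @ [v])"
    and N: "\<And>w. w \<in> N \<Longrightarrow> {v, w} \<in> E" "finite N" and F: "finite F"
  shows "card {w \<in> N. w \<notin> set q \<and> c {v, w} \<in> c ` set (path_edges (q @ [v])) \<union> F}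
    \<le> length q - 1 + card F"
proof (cases q rule: rev_cases)
  case Nil
  then show ?thesis using card_neighbours_coloured_le[OF c N(1) F] by simp
next
  case (snoc q' u)
  let ?D = "c ` set (path_edges (q' @ [u])) \<union> F"
  have uv: "{v, u} \<in> E" using p snoc by (simp add: rainbow_path_snoc insert_commute)
  have "{w \<in> N. w \<notin> set q \<and> c {v, w} \<in> c ` set (path_edges (q @ [v])) \<union> F} \<subseteq>
      {w \<in> N. c {v, w} \<in> ?D}"
    using proper_neq[OF c N(1) uv] by (auto simp: snoc path_edges_snoc insert_commute[of u v])
  then have "card {w \<in> N. w \<notin> set q \<and> c {v, w} \<in> c ` set (path_edges (q @ [v])) \<union> F} \<le>
      card {w \<in> N. c {v, w} \<in> ?D}"
    using N(2) by (intro card_mono) auto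
  also have "\<dots> \<le> card ?D" by (rule card_neighbours_coloured_le[OF c N(1)]) (use F in auto)
  also have "\<dots> \<le> card (c ` set (path_edges (q' @ [u]))) + card F" by (rule card_Un_le)
  also have "card (c ` set (path_edges (q' @ [u]))) \<le> length (path_edges (q' @ [u]))"
    using card_length[of "map c (path_edges (q' @ [u]))"] by simp
  finally show ?thesis by (simp add: length_path_edges snoc)
qed

text \<open>A candidate in \<open>N\<close> is lost if it lies on \<open>q\<close> or if its edge at
  \<open>v\<close> repeats a colour of the path. The path has \<open>length q\<close> edges, but the
  one ending at \<open>v\<close> cannot clash with another edge at \<open>v\<close>.\<close>

lemma extend_path:
  assumes c: "proper E c" and p: "rainbow_path E c (q @ [v])"
    and N: "\<And>w. w \<in> N \<Longrightarrow> {v, w} \<in> E" "finite N" "v \<notin> N"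
    and large: "card (N \<inter> set q) + (length q - 1) < card N"
  obtains w where "w \<in> N" "rainbow_path E c (q @ [v, w])"
proof -
  let ?X = "{w \<in> N. w \<notin> set q \<and> c {v, w} \<in> c ` set (path_edges (q @ [v])) \<union> {}}"
  have "card (N \<inter> set q \<union> ?X) \<le> card (N \<inter> set q) + card ?X" by (rule card_Un_le)
  also have "card ?X \<le> length q - 1" using card_blocked_le[OF c p N(1,2), of "{}"] by simp
  finally have "card (N \<inter> set q \<union> ?X) < card N" using large by simp
  then have "\<not> N \<subseteq> N \<inter> set q \<union> ?X"
    using N(2) card_mono[of "N \<inter> set q \<union> ?X" N] by (auto simp: not_le)
  then obtain w where "w \<in> N" "w \<notin> set q" "c {v, w} \<notin> c ` set (path_edges (q @ [v]))" by auto
  then show ?thesis using that[of w] p N by (auto simp: rainbow_path_snoc)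
qed

text \<open>A detour from \<open>a\<close> to the prescribed \<open>a'\<close>, avoiding the
  reserved vertices \<open>W\<close> and the reserved colours \<open>F\<close>. Colour clashes cost
  \<open>length q - 1 + card F\<close> candidates at \<open>a\<close> and
  \<open>length q + card F\<close> at \<open>a'\<close>, where no path edge ends yet. The two new
  edges differ in colour because they share \<open>b\<close>.\<close>

lemma extend_path_two:
  assumes c: "proper E c" and p: "rainbow_path E c (q @ [a])"
    and B: "\<And>b. b \<in> B \<Longrightarrow> {a, b} \<in> E" "\<And>b. b \<in> B \<Longrightarrow> {a', b} \<in> E" "finite B" "a \<notin> B" "a' \<notin> B"
    and a': "a' \<notin> set q" "a' \<noteq> a" and F: "finite F"
    and large: "card (B \<inter> (set q \<union> W)) + (length q - 1) + length q + 2 * card F < card B"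
  obtains b where "b \<in> B - W" "b \<notin> set q" "rainbow_path E c (q @ [a, b, a'])"
    "c {a, b} \<notin> F" "c {b, a'} \<notin> F"
proof -
  let ?D = "c ` set (path_edges (q @ [a]))"
  let ?X = "{w \<in> B. w \<notin> set q \<and> c {a, w} \<in> ?D \<union> F}"
  let ?Y = "{w \<in> B. c {a', w} \<in> ?D \<union> F}"
  have "card (B \<inter> (set q \<union> W) \<union> ?X \<union> ?Y) \<le> card (B \<inter> (set q \<union> W)) + card ?X + card ?Y"
    by (meson add_mono_thms_linordered_semiring(3) card_Un_le le_trans)
  also have "card ?X \<le> length q - 1 + card F" by (rule card_blocked_le[OF c p B(1,3) F])
  also have "card ?Y \<le> card (?D \<union> F)"
    by (rule card_neighbours_coloured_le[OF c B(2)]) (use F in auto)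
  also have "card (?D \<union> F) \<le> card ?D + card F" by (rule card_Un_le)
  also have "card ?D \<le> length q"
    using card_length[of "map c (path_edges (q @ [a]))"] by (simp add: length_path_edges)
  finally have "card (B \<inter> (set q \<union> W) \<union> ?X \<union> ?Y) < card B" using large by simp
  then have "\<not> B \<subseteq> B \<inter> (set q \<union> W) \<union> ?X \<union> ?Y"
    using B(3) card_mono[of "B \<inter> (set q \<union> W) \<union> ?X \<union> ?Y" B] by (auto simp: not_le)
  then obtain b where b: "b \<in> B" "b \<notin> W" "b \<notin> set q" "c {a, b} \<notin> ?D \<union> F" "c {a', b} \<notin> ?D \<union> F"
    by auto
  have comm: "{b, a} = {a, b}" "{b, a'} = {a', b}" by auto
  have "c {a', b} \<noteq> c {a, b}"
    using proper_neq[OF c, of b a' a] B(1,2)[OF b(1)] a'(2) by (simp add: comm)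
  moreover have r1: "rainbow_path E c (q @ [a, b])"
    using p b B by (auto simp: rainbow_path_snoc)
  ultimately have "rainbow_path E c ((q @ [a]) @ [b, a'])"
    unfolding rainbow_path_snoc comm
    using b B a' by (auto simp: path_edges_snoc rainbow_path_snoc)
  then show ?thesis using that[of b] b by (simp add: comm)
qed

text \<open>Alternate between \<open>B\<close> and prescribed vertices \<open>as\<close> on the other side. Every two steps
  forbid at most five further elements of \<open>B\<close>.\<close>

lemma thread_path:
  assumes c: "proper E c" and p: "rainbow_path E c (q @ [a])"
    and B: "finite B" "\<And>x b. x \<in> insert a (set as) \<Longrightarrow> b \<in> B \<Longrightarrow> {x, b} \<in> E"
    and as: "distinct (a # as)" "set as \<inter> set q = {}" "insert a (set as) \<inter> B = {}"
    and F: "finite F"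
    and large: "as \<noteq> [] \<Longrightarrow> card (B \<inter> (set q \<union> W)) + (length q - 1) + length q + 2 * card F
      + 5 * (length as - 1) < card B"
  obtains r where "rainbow_path E c (q @ [a] @ r)" "length r = 2 * length as"
    "last (a # r) = last (a # as)" "set r \<subseteq> set as \<union> (B - W)"
    "c ` set (path_edges (a # r)) \<inter> F = {}" "card (B \<inter> set r) \<le> length as"
  using p B(2) as large that
proof (induction as arbitrary: q a thesis)
  case Nil
  then show ?case by force
next
  case (Cons a' as)
  obtain b where b: "b \<in> B - W" "b \<notin> set q" "rainbow_path E c (q @ [a, b, a'])"
    "c {a, b} \<notin> F" "c {b, a'} \<notin> F"
    by (rule extend_path_two[OF c Cons.prems(2), of B a' F W]) (use Cons.prems B(1) F in auto)
  \<comment> \<open>Passing from \<open>q\<close> to \<open>?q\<close> adds at most one vertex to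
    the intersection with \<open>B\<close> and 2 to each of the two length terms: this is the 5 in
    \<open>large\<close>.\<close>
  let ?q = "q @ [a, b]"
  have le: "card (B \<inter> (set ?q \<union> W)) \<le> Suc (card (B \<inter> (set q \<union> W)))"
  proof -
    have "B \<inter> (set ?q \<union> W) \<subseteq> insert b (B \<inter> (set q \<union> W))" using Cons.prems(6) by auto
    then have "card (B \<inter> (set ?q \<union> W)) \<le> card (insert b (B \<inter> (set q \<union> W)))"
      using B(1) by (intro card_mono) auto
    also have "\<dots> \<le> Suc (card (B \<inter> (set q \<union> W)))" by (rule card_insert_le_m1) auto
    finally show ?thesis .
  qed
  obtain r where r: "rainbow_path E c (?q @ [a'] @ r)" "length r = 2 * length as"
    "last (a' # r) = last (a' # as)" "set r \<subseteq> set as \<union> (B - W)"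
    "c ` set (path_edges (a' # r)) \<inter> F = {}" "card (B \<inter> set r) \<le> length as"
  proof (rule Cons.IH[of ?q a'])
    show "rainbow_path E c (?q @ [a'])" using b by simp
    show "set as \<inter> set ?q = {}" using Cons.prems b by auto
    show "card (B \<inter> (set ?q \<union> W)) + (length ?q - 1) + length ?q + 2 * card F
      + 5 * (length as - 1) < card B" if "as \<noteq> []"
      using that le Cons.prems(7) by (cases as) auto
  qed (use Cons.prems in auto)
  show ?case
  proof (rule Cons.prems(1)[of "b # a' # r"])
    show "rainbow_path E c (q @ [a] @ b # a' # r)" using r(1) by simp
    have "B \<inter> set (b # a' # r) = insert b (B \<inter> set r)" using b Cons.prems(6) by auto
    then show "card (B \<inter> set (b # a' # r)) \<le> length (a' # as)"
      using r(6) card_insert_le_m1[of "Suc (length as)" "B \<inter> set r" b] by simp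
  qed (use r b in auto)
qed

section \<open>Complete bipartite graphs with pendant edges\<close>

text \<open>A complete bipartite graph on \<open>A\<close> and \<open>B\<close> with pendant edges at the vertices of \<open>P\<close>. It
  contains no path on \<open>k\<close> vertices at all, because \<open>A\<close> is too small.\<close>

locale pendant_bipartite =
  fixes A B L P :: "'a set" and par :: "'a \<Rightarrow> 'a" and k :: nat
  assumes disj: "A \<inter> B = {}" "A \<inter> L = {}" "B \<inter> L = {}"
    and fin: "finite A" "finite B" "finite L"
    and P: "P \<subseteq> B" "P \<noteq> {}" "par ` L \<subseteq> P"
    and A2: "2 \<le> card A" and B5: "5 * card A \<le> Suc (card B)"
    and L_large: "\<And>p. p \<in> P \<Longrightarrow> 4 * card A + 3 < card {x \<in> L. par x = p}"
    and k: "P = B \<and> k = 2 * card A + 4 \<or> card P = 1 \<and> k = 2 * card A + 3"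
begin

definition E :: "'a set set" where
  "E = {{a, b} | a b. a \<in> A \<and> b \<in> B} \<union> {{x, par x} | x. x \<in> L}"

lemma AB_edge: "a \<in> A \<Longrightarrow> b \<in> B \<Longrightarrow> {a, b} \<in> E"
  by (auto simp: E_def)

lemma L_edge: "x \<in> L \<Longrightarrow> {x, par x} \<in> E"
  by (auto simp: E_def)

lemma par_B: "x \<in> L \<Longrightarrow> par x \<in> B"
  using P by auto

lemma simple: "simple_graph (A \<union> B \<union> L, E)"
proof -
  have "e \<subseteq> A \<union> B \<union> L \<and> card e = 2" if "e \<in> E" for e
    using that disj par_B unfolding E_def by (fastforce simp: card_2_iff)
  then show ?thesis using fin by (simp add: simple_graph_def)
qed

lemma leaf_edge: "{x, y} \<in> E \<Longrightarrow> x \<in> L \<Longrightarrow> y = par x"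
  using disj par_B unfolding E_def by (auto simp: doubleton_eq_iff)

lemma edge_meets_A: "{x, y} \<in> E \<Longrightarrow> x \<notin> L \<Longrightarrow> y \<notin> L \<Longrightarrow> x \<in> A \<or> y \<in> A"
  unfolding E_def by (auto simp: doubleton_eq_iff)

text \<open>Leaves occur only as ends of a path. If \<open>P = B\<close>, the interior is a
  leaf-free stretch of \<open>2 * card A + 2\<close> vertices. If \<open>P\<close> is a singleton,
  the two ends cannot both be leaves, as these hang at the same vertex, so such a stretch starts at
  index 0 or 1. It splits into \<open>card A + 1\<close> disjoint edges, each meeting
  \<open>A\<close>.\<close>

lemma no_long_path: "rainbow_free k E c"
  unfolding rainbow_free_def
proof
  assume "\<exists>p. length p = k \<and> rainbow_path E c p"
  then obtain p where p: "length p = k" "distinct p" "set (path_edges p) \<subseteq> E"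
    by (auto simp: rainbow_path_def)
  have edge: "{p ! i, p ! Suc i} \<in> E" if "Suc i < k" for i
    using p(1,3) that by (auto simp: path_edges_conv_nth)
  have ne: "p ! i \<noteq> p ! j" if "i < k" "j < k" "i \<noteq> j" for i j
    using p(1,2) that by (simp add: nth_eq_iff_index_eq)
  have interior: "p ! i \<notin> L" if i: "0 < i" "Suc i < k" for i
    using path_interior_not_leaf[OF p(2,3) i(1)] i(2) p(1) leaf_edge by metis
  have "\<exists>d\<le>1. d + 2 * card A + 1 < k \<and> (\<forall>i\<le>d + 2 * card A + 1. d \<le> i \<longrightarrow> p ! i \<notin> L)"
  proof -
    from k consider "k = 2 * card A + 4" | "card P = 1" "k = 2 * card A + 3" by blast
    then show ?thesis
    proof cases
      case 1
      then show ?thesis using interior by (intro exI[of _ 1]) auto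
    next
      case 2
      show ?thesis
      proof (cases "p ! 0 \<in> L")
        case False
        have "p ! i \<notin> L" if "i \<le> 2 * card A + 1" for i
          using False interior[of i] that 2 by (cases i) auto
        then show ?thesis using 2 by (intro exI[of _ 0]) auto
      next
        case True
        have last: "p ! (2 * card A + 2) \<notin> L"
        proof
          assume "p ! (2 * card A + 2) \<in> L"
          then have "par (p ! (2 * card A + 2)) = p ! (2 * card A + 1)"
            using leaf_edge[of "p ! (2 * card A + 2)" "p ! (2 * card A + 1)"]
              edge[of "2 * card A + 1"] 2 by (simp add: insert_commute)
          moreover have "par (p ! 0) = p ! 1" using True leaf_edge edge[of 0] 2 by simp
          moreover obtain b where "P = {b}" using 2(1) by (rule card_1_singletonE)
          then have "par (p ! 0) = par (p ! (2 * card A + 2))"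
            using P(3) True \<open>p ! (2 * card A + 2) \<in> L\<close> by blast
          ultimately show False using ne[of 1 "2 * card A + 1"] 2 A2 by simp
        qed
        have "p ! i \<notin> L" if "1 \<le> i" "i \<le> 2 * card A + 2" for i
          using last interior[of i] that 2 by (cases "i = 2 * card A + 2") auto
        then show ?thesis using 2 by (intro exI[of _ 1]) auto
      qed
    qed
  qed
  then obtain d where d: "d + 2 * card A + 1 < k"
    "\<And>i. d \<le> i \<Longrightarrow> i \<le> d + 2 * card A + 1 \<Longrightarrow> p ! i \<notin> L" by blast
  \<comment> \<open>The position of a vertex of \<open>A\<close> in the \<open>j\<close>-th pair of
    consecutive vertices of the leaf-free stretch.\<close>
  define f where "f j = (if p ! (d + 2 * j) \<in> A then d + 2 * j else Suc (d + 2 * j))" for j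
  have "p ! f j \<in> A" if "j \<in> {..card A}" for j
    using edge_meets_A[OF edge[of "d + 2 * j"]] d(2)[of "d + 2 * j"] d(2)[of "Suc (d + 2 * j)"]
      that d(1) by (auto simp: f_def)
  moreover have "inj_on (\<lambda>j. p ! f j) {..card A}"
  proof (rule inj_onI)
    fix i j assume ij: "i \<in> {..card A}" "j \<in> {..card A}" "p ! f i = p ! f j"
    then have "f i < k" "f j < k" using d(1) by (auto simp: f_def)
    then have "f i = f j" using ne ij(3) by blast
    moreover have "f i = d + 2 * i \<or> f i = Suc (d + 2 * i)" "f j = d + 2 * j \<or> f j = Suc (d + 2 * j)"
      by (simp_all add: f_def)
    ultimately show "i = j" by presburger
  qed
  ultimately have "card {..card A} \<le> card A" using fin(1) by (intro card_inj_on_le) auto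
  then show False by simp
qed

lemma sibling:
  assumes "proper E' c" "E \<subseteq> E'" "p \<in> P"
  obtains x where "x \<in> L" "par x = p" "x \<noteq> z" "c {x, p} \<noteq> n"
proof -
  let ?N = "{x \<in> L. par x = p}"
  have "card {w \<in> ?N. c {p, w} \<in> {n}} \<le> card {n}"
    by (rule card_neighbours_coloured_le[OF assms(1)])
       (use L_edge assms(2) in \<open>auto simp: insert_commute\<close>)
  then have "card (insert z {w \<in> ?N. c {p, w} \<in> {n}}) \<le> 2"
    using card_insert_le_m1[of 2 "{w \<in> ?N. c {p, w} \<in> {n}}" z] by simp
  then have "\<not> ?N \<subseteq> insert z {w \<in> ?N. c {p, w} \<in> {n}}"
    using L_large[OF assms(3)] fin(3) card_mono[of "insert z {w \<in> ?N. c {p, w} \<in> {n}}" ?N] by auto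
  then show ?thesis using that by (auto simp: insert_commute)
qed

text \<open>Two edges from \<open>b\<close> into \<open>A\<close> have different colours, so one of
  them avoids \<open>n\<close>. This is where the small part must have two vertices.\<close>

lemma choose_A:
  assumes "proper E' c" "E \<subseteq> E'" "b \<in> B"
  obtains a where "a \<in> A" "c {b, a} \<noteq> n"
proof -
  obtain a a' where "a \<in> A" "a' \<in> A" "a \<noteq> a'"
    using A2 card_le_Suc0_iff_eq[OF fin(1)] by (metis not_less_eq_eq numeral_2_eq_2)
  moreover have "{b, a} \<in> E'" "{b, a'} \<in> E'"
    using calculation assms AB_edge by (auto simp: insert_commute)
  ultimately show ?thesis using that proper_neq[OF assms(1)] by metis
qed

text \<open>In the original graph only two vertices, a leaf and its parent, can precede the first
  vertex of \<open>A\<close>; the third one is the gain from the new edge. Visiting all of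
  \<open>A\<close> gives \<open>2 * card A + 2\<close> vertices, one more vertex of \<open>B\<close>
  settles odd \<open>k\<close>, and a leaf at that vertex settles even \<open>k\<close>.\<close>

lemma long_path_from:
  assumes c: "proper E' c" "E \<subseteq> E'"
    and p: "rainbow_path E' c ([x, y, z] @ [a])" and a: "a \<in> A"
    and q: "A \<inter> {x, y, z} = {}" "card (B \<inter> {x, y, z}) \<le> 2"
  shows "\<not> rainbow_free k E' c"
proof -
  obtain as where as: "set as = A - {a}" "distinct as"
    using finite_distinct_list fin(1) by (metis finite_Diff)
  have las: "Suc (length as) = card A"
    using as a fin(1) distinct_card[of as] card_Suc_Diff1[of A a] by simp
  obtain r where r: "rainbow_path E' c ([x, y, z] @ [a] @ r)" "length r = 2 * length as"
    "last (a # r) = last (a # as)" "set r \<subseteq> set as \<union> B" "card (B \<inter> set r) \<le> length as"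
  proof (rule thread_path[OF c(1) p fin(2), of as "{}" "{}"])
    show "\<And>u b. u \<in> insert a (set as) \<Longrightarrow> b \<in> B \<Longrightarrow> {u, b} \<in> E'" using AB_edge as a c(2) by blast
    show "set as \<inter> set [x, y, z] = {}" "insert a (set as) \<inter> B = {}" using as a q disj by auto
    \<comment> \<open>The left side is at most 2 + 2 + 3 plus 5 for each vertex of \<open>as\<close>
      but one, that is \<open>5 * card A - 3\<close>.\<close>
    show "card (B \<inter> (set [x, y, z] \<union> {})) + (length [x, y, z] - 1) + length [x, y, z] +
        2 * card {} + 5 * (length as - 1) < card B" if "as \<noteq> []"
      using that B5 las q(2) by (cases as) auto
  qed (use as in auto)
  define q' v where "q' = butlast ([x, y, z] @ a # r)" and "v = last (a # r)"
  have q'v: "q' @ [v] = [x, y, z] @ [a] @ r" by (simp add: q'_def v_def)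
  have "v \<in> set (a # as)" unfolding v_def r(3) by (rule last_in_set) simp
  then have vA: "v \<in> A" using as a by auto
  have len: "length q' = 2 * card A + 1" using arg_cong[OF q'v, of length] r(2) las by simp
  obtain b where b: "b \<in> B" "rainbow_path E' c (q' @ [v, b])"
  proof (rule extend_path[OF c(1), of q' v B])
    have "B \<inter> set q' \<subseteq> B \<inter> {x, y, z} \<union> B \<inter> set r"
      using a disj unfolding q'_def by (auto dest!: in_set_butlastD)
    then have "card (B \<inter> set q') \<le> card (B \<inter> {x, y, z} \<union> B \<inter> set r)"
      using fin(2) by (intro card_mono) auto
    also have "\<dots> \<le> card (B \<inter> {x, y, z}) + card (B \<inter> set r)" by (rule card_Un_le)
    finally show "card (B \<inter> set q') + (length q' - 1) < card B"
      using q(2) r(5) las len B5 A2 by linarith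
  qed (use r(1) q'v vA disj fin AB_edge c(2) in auto)
  from k show ?thesis
  proof
    assume "card P = 1 \<and> k = 2 * card A + 3"
    then show ?thesis using b(2) len unfolding rainbow_free_def
      by (intro notI) (auto dest!: spec[of _ "q' @ [v, b]"])
  next
    assume PB: "P = B \<and> k = 2 * card A + 4"
    let ?N = "{x \<in> L. par x = b}"
    obtain w where "rainbow_path E' c ((q' @ [v]) @ [b, w])"
    proof (rule extend_path[OF c(1), of "q' @ [v]" b ?N])
      \<comment> \<open>At most \<open>2 * card A + 2\<close> leaves lie on the path and
        \<open>2 * card A + 1\<close> are lost to colours: the constant in
        \<open>L_large\<close>.\<close>
      have "card (?N \<inter> set (q' @ [v])) \<le> card (set (q' @ [v]))" by (intro card_mono) auto
      also have "\<dots> \<le> length (q' @ [v])" by (rule card_length)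
      finally show "card (?N \<inter> set (q' @ [v])) + (length (q' @ [v]) - 1) < card ?N"
        using L_large[of b] b(1) PB len by simp
    qed (use b fin L_edge c(2) disj in \<open>auto simp: insert_commute\<close>)
    then show ?thesis using len PB unfolding rainbow_free_def
      by (intro notI) (auto dest!: spec[of _ "q' @ [v, b, w]"])
  qed
qed

text \<open>If one end carries leaves, leaf, \<open>b\<close>, \<open>b'\<close> is a start with
  three vertices outside \<open>A\<close>. Otherwise \<open>P\<close> is a single vertex
  \<open>p\<close> off the new edge. The path then starts with the new edge, visits all of
  \<open>A\<close>, and ends with \<open>a2\<close>, \<open>p\<close> and a leaf; for this
  \<open>p\<close> and the colour of \<open>{p, a2}\<close> are reserved throughout.\<close>

lemma inner_edge:
  assumes c: "proper E' c" "E \<subseteq> E'" and e: "{b, b'} \<in> E'" "b \<in> B" "b' \<in> B" "b \<noteq> b'"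
  shows "\<not> rainbow_free k E' c"
proof (cases "b \<in> P \<or> b' \<in> P")
  case True
  have *: "\<not> rainbow_free k E' c" if bb: "{b, b'} \<in> E'" "b \<in> P" "b' \<in> B" "b \<noteq> b'" for b b'
  proof -
    obtain x where x: "x \<in> L" "par x = b" using sibling[OF c bb(2)] by metis
    obtain a where a: "a \<in> A" "c {b', a} \<noteq> c {x, b}" using choose_A[OF c bb(3)] by metis
    have edges: "{x, b} \<in> E'" "{b', a} \<in> E'"
      using L_edge[OF x(1)] AB_edge[OF a(1) bb(3)] c(2) x by (auto simp: insert_commute)
    have "c {b, x} \<noteq> c {b, b'}" "c {b', b} \<noteq> c {b', a}"
      using proper_neq[OF c(1), of b x b'] proper_neq[OF c(1), of b' b a] bb edges x a disj P
      by (auto simp: insert_commute)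
    then have "rainbow_path E' c ([x, b, b'] @ [a])"
      using x a bb edges disj P by (auto simp: rainbow_path_def insert_commute)
    then show ?thesis
    proof (rule long_path_from[OF c _ a(1)])
      show "A \<inter> {x, b, b'} = {}" using x bb disj P by auto
      have "B \<inter> {x, b, b'} \<subseteq> {b, b'}" using x disj by auto
      then have "card (B \<inter> {x, b, b'}) \<le> card {b, b'}" by (intro card_mono) auto
      then show "card (B \<inter> {x, b, b'}) \<le> 2" using bb(4) by simp
    qed
  qed
  show ?thesis
    using True *[of b b'] *[of b' b] e by (auto simp: insert_commute)
next
  case False
  then have kP: "card P = 1" "k = 2 * card A + 3" using k e by auto
  then obtain p where p: "P = {p}" by (auto simp: card_1_singleton_iff)
  then have pB: "p \<in> B" "p \<noteq> b" "p \<noteq> b'" using P False by auto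
  obtain a2 where a2: "a2 \<in> A" "c {p, a2} \<noteq> c {b, b'}" using choose_A[OF c pB(1)] by metis
  have "\<not> A \<subseteq> {a2}"
    using A2 card_mono[of "{a2}" A] by auto
  then obtain a1 where a1: "a1 \<in> A" "a1 \<noteq> a2" by auto
  have ab: "{a, u} \<in> E'" "{u, a} \<in> E'" if "a \<in> A" "u \<in> B" for a u
    using AB_edge[OF that] c(2) by (auto simp: insert_commute)
  have main: "\<not> rainbow_free k E' c"
    if bb: "{b, b'} \<in> E'" "b \<in> B" "b' \<in> B" "b \<noteq> b'" "p \<noteq> b" "p \<noteq> b'"
      "c {p, a2} \<noteq> c {b, b'}" "c {b', a1} \<noteq> c {p, a2}" for b b'
  proof -
    have start: "rainbow_path E' c ([b, b'] @ [a1])"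
      using proper_neq[OF c(1), of b' b a1] bb a1 ab[of a1 b'] disj
      by (auto simp: rainbow_path_def insert_commute)
    obtain as where as: "set as = A - {a1, a2}" "distinct as"
      using finite_distinct_list fin(1) by (metis finite_Diff)
    have "card {a1, a2} = 2" using a1 by simp
    then have las: "length as + 2 = card A"
      using as a1 a2 fin(1) A2 distinct_card[of as] card_Diff_subset[of "{a1, a2}" A] by simp
    obtain r where r: "rainbow_path E' c ([b, b'] @ [a1] @ r)" "length r = 2 * length (as @ [a2])"
      "last (a1 # r) = last (a1 # as @ [a2])" "set r \<subseteq> set (as @ [a2]) \<union> (B - {p})"
      "c ` set (path_edges (a1 # r)) \<inter> {c {p, a2}} = {}"
    proof (rule thread_path[OF c(1) start fin(2), of "as @ [a2]" "{c {p, a2}}" "{p}"])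
      show "\<And>u b. u \<in> insert a1 (set (as @ [a2])) \<Longrightarrow> b \<in> B \<Longrightarrow> {u, b} \<in> E'"
        using ab as a1 a2 by auto
      show "set (as @ [a2]) \<inter> set [b, b'] = {}" "insert a1 (set (as @ [a2])) \<inter> B = {}"
        using as a1 a2 bb disj by auto
      have "B \<inter> (set [b, b'] \<union> {p}) = {b, b', p}" using bb pB by auto
      then have "card (B \<inter> (set [b, b'] \<union> {p})) = 3" using bb by auto
      \<comment> \<open>The left side is 3 + 1 + 2 + 2 plus 5 for each threaded vertex but one, that
        is \<open>5 * card A - 2\<close>: here \<open>B5\<close> is used at full strength.\<close>
      then show "card (B \<inter> (set [b, b'] \<union> {p})) + (length [b, b'] - 1) + length [b, b'] +
          2 * card {c {p, a2}} + 5 * (length (as @ [a2]) - 1) < card B"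
        using las B5 by simp
    qed (use as a1 a2 in auto)
    define q where "q = butlast ([b, b'] @ [a1] @ r)"
    have qa2: "q @ [a2] = [b, b'] @ [a1] @ r"
      using append_butlast_last_id[of "[b, b'] @ [a1] @ r"] r(3) by (simp add: q_def)
    have "rainbow_path E' c (q @ [a2, p])"
      unfolding rainbow_path_snoc qa2
    proof (intro conjI)
      have "p \<notin> set ([b, b'] @ [a1] @ r)"
        using r(4) bb pB a1 a2 as disj by auto
      then show "p \<notin> set q" "p \<noteq> a2" unfolding qa2[symmetric] by auto
      show "c {a2, p} \<notin> c ` set (path_edges ([b, b'] @ [a1] @ r))"
        using r(5) bb(7,8) by (auto simp: insert_commute)
    qed (use r(1) ab a2 pB in auto)
    then have qp: "rainbow_path E' c ((q @ [a2]) @ [p])" by simp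
    have len: "length q = 2 * card A"
      using arg_cong[OF qa2, of length] r(2) las by simp
    let ?N = "{x \<in> L. par x = p}"
    obtain w where w: "rainbow_path E' c ((q @ [a2]) @ [p, w])"
    proof (rule extend_path[OF c(1) qp, of ?N])
      have "card (?N \<inter> set (q @ [a2])) \<le> card (set (q @ [a2]))" by (intro card_mono) auto
      also have "\<dots> \<le> length (q @ [a2])" by (rule card_length)
      finally show "card (?N \<inter> set (q @ [a2])) + (length (q @ [a2]) - 1) < card ?N"
        using L_large[of p] p len by simp
    qed (use fin L_edge c(2) pB disj in \<open>auto simp: insert_commute\<close>)
    then show ?thesis using len kP unfolding rainbow_free_def
      by (intro notI) (auto dest!: spec[of _ "q @ [a2, p, w]"])
  qed
  \<comment> \<open>The edges from \<open>a1\<close> to \<open>b\<close> and \<open>b'\<close>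
    differ in colour, so at least one avoids the reserved colour; this decides in which direction
    the new edge is traversed.\<close>
  have "c {b', a1} \<noteq> c {p, a2} \<or> c {b, a1} \<noteq> c {p, a2}"
    using proper_neq[OF c(1), of a1 b b'] ab[OF a1(1)] e by (auto simp: insert_commute)
  moreover have comm: "{b', b} = {b, b'}" by auto
  ultimately show ?thesis
    using main[OF e pB(2,3) a2(2)] main[of b' b, unfolded comm, OF e(1,3,2) e(4)[symmetric] pB(3,2) a2(2)]
    by blast
qed

text \<open>A new pair without leaves and not inside \<open>A\<close> lies inside \<open>B\<close>.
  If it contains a leaf \<open>x\<close> and another vertex \<open>z\<close>, the start is sibling,
  parent, \<open>x\<close> followed by \<open>z\<close> when \<open>z\<close> is in
  \<open>A\<close>, and \<open>z\<close>, \<open>x\<close>, parent followed by some vertex of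
  \<open>A\<close> otherwise.\<close>

lemma forced:
  assumes e: "e \<in> non_edges (A \<union> B \<union> L, E)" "\<not> e \<subseteq> A" and c: "proper (insert e E) c"
  shows "\<not> rainbow_free k (insert e E) c"
proof -
  let ?E = "insert e E"
  have sub: "E \<subseteq> ?E" by auto
  have eV: "e \<subseteq> A \<union> B \<union> L" "card e = 2" "e \<notin> E" using e by (auto simp: non_edges_def)
  show ?thesis
  proof (cases "e \<inter> L = {}")
    case True
    obtain u v where uv: "e = {u, v}" "u \<noteq> v" using eV(2) by (auto simp: card_2_iff)
    have "u \<in> B" "v \<in> B" using uv eV e(2) True AB_edge[of u v] AB_edge[of v u]
      by (auto simp: insert_commute)
    then show ?thesis using inner_edge[OF c sub, of u v] uv by simp
  next
    case False
    then obtain x z where xz: "e = {x, z}" "x \<noteq> z" "x \<in> L"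
      using eV(2) by (auto simp: card_2_iff insert_commute)
    let ?p = "par x"
    have pP: "?p \<in> P" using P xz by auto
    have pB: "?p \<in> B" using pP P by auto
    have zp: "z \<noteq> ?p" using L_edge[OF xz(3)] eV xz by auto
    have px: "{x, ?p} \<in> ?E" using L_edge[OF xz(3)] by auto
    have xz': "{x, z} \<in> ?E" using xz by simp
    have "c {x, z} \<noteq> c {x, ?p}" using proper_neq[OF c xz' px] zp by simp
    show ?thesis
    proof (cases "z \<in> A")
      case zA: True
      obtain y where y: "y \<in> L" "par y = ?p" "y \<noteq> x" "c {y, ?p} \<noteq> c {x, z}"
        using sibling[OF c sub pP] by metis
      have py: "{y, ?p} \<in> ?E" using L_edge[OF y(1)] y(2) by auto
      have "c {?p, y} \<noteq> c {?p, x}"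
        using proper_neq[OF c, of ?p y x] py px y(3) by (simp add: insert_commute)
      then have "rainbow_path ?E c ([y, ?p, x] @ [z])"
        using y px py xz' \<open>c {x, z} \<noteq> c {x, ?p}\<close> zA xz pB disj
        by (auto simp: rainbow_path_def insert_commute)
      then show ?thesis
      proof (rule long_path_from[OF c sub _ zA])
        have "B \<inter> {y, ?p, x} \<subseteq> {?p}" using y xz disj by auto
        then have "card (B \<inter> {y, ?p, x}) \<le> card {?p}" by (intro card_mono) auto
        then show "card (B \<inter> {y, ?p, x}) \<le> 2" by simp
      qed (use y xz pB disj in auto)
    next
      case zA: False
      obtain a where a: "a \<in> A" "c {?p, a} \<noteq> c {z, x}" using choose_A[OF c sub pB] by metis
      have pa: "{?p, a} \<in> ?E" using AB_edge[OF a(1) pB] by (auto simp: insert_commute)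
      have "c {?p, a} \<noteq> c {?p, x}"
        using proper_neq[OF c pa, of x] px a xz disj by (auto simp: insert_commute)
      then have "rainbow_path ?E c ([z, x, ?p] @ [a])"
        using a px pa xz' \<open>c {x, z} \<noteq> c {x, ?p}\<close> zA zp xz pB disj
        by (auto simp: rainbow_path_def insert_commute)
      then show ?thesis
      proof (rule long_path_from[OF c sub _ a(1)])
        have "B \<inter> {z, x, ?p} \<subseteq> {z, ?p}" using xz disj by auto
        then have "card (B \<inter> {z, x, ?p}) \<le> card {z, ?p}" by (intro card_mono) auto
        then show "card (B \<inter> {z, x, ?p}) \<le> 2" using zp by simp
      qed (use xz zA pB disj in auto)
    qed
  qed
qed

lemma card_E: "card E = card A * card B + card L"
proof -
  have "inj_on (\<lambda>(a, b). {a, b}) (A \<times> B)"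
    using disj(1) by (auto simp: inj_on_def doubleton_eq_iff)
  moreover have "{{a, b} | a b. a \<in> A \<and> b \<in> B} = (\<lambda>(a, b). {a, b}) ` (A \<times> B)" by auto
  ultimately have 1: "card {{a, b} | a b. a \<in> A \<and> b \<in> B} = card A * card B"
    by (simp add: card_image card_cartesian_product)
  have "inj_on (\<lambda>x. {x, par x}) L"
    using disj(3) par_B by (fastforce simp: inj_on_def doubleton_eq_iff)
  moreover have "{{x, par x} | x. x \<in> L} = (\<lambda>x. {x, par x}) ` L" by auto
  ultimately have 2: "card {{x, par x} | x. x \<in> L} = card L" by (simp add: card_image)
  have "{{a, b} | a b. a \<in> A \<and> b \<in> B} \<inter> {{x, par x} | x. x \<in> L} = {}"
    using disj by (auto simp: doubleton_eq_iff)
  moreover have "finite {{a, b} | a b. a \<in> A \<and> b \<in> B}" "finite {{x, par x} | x. x \<in> L}"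
    using finite_edges[OF simple] by (auto simp: E_def)
  ultimately show ?thesis unfolding E_def using 1 2 by (simp add: card_Un_disjoint)
qed

end

text \<open>Pairs inside \<open>A\<close> are not forced; the binomial coefficient pays for all of
  them.\<close>

lemma sat_star_pendant_bipartite:
  fixes A B L P :: "nat set"
  assumes "pendant_bipartite A B L P par k"
  shows "sat_star (card A + card B + card L) (path_graph k)
    \<le> card A * card B + card L + (card A choose 2)"
proof -
  interpret pendant_bipartite A B L P par k by fact
  let ?X = "{e. e \<subseteq> A \<and> card e = 2}"
  obtain c :: "nat set \<Rightarrow> nat" where "inj_on c E"
    using finite_imp_inj_to_nat_seg[OF finite_edges[OF simple]] by auto
  then have "proper E c" by (auto simp: proper_def inj_on_def)
  have "sat_star (card A + card B + card L) (path_graph k) \<le> card E + card ?X"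
  proof (rule sat_star_path_le[OF simple _ _ \<open>proper E c\<close> no_long_path])
    show "card (A \<union> B \<union> L) = card A + card B + card L"
      using fin disj by (simp add: card_Un_disjoint Int_Un_distrib2)
    show "2 \<le> k" using k by auto
    show "finite ?X" using fin(1) by simp
  qed (use forced in \<open>auto simp: non_edges_def\<close>)
  then show ?thesis using card_E n_subsets[OF fin(1), of 2] by simp
qed

section \<open>Paths on six vertices\<close>

text \<open>More than four leaves per vertex: the last extension in \<open>forced\<close> can lose
  one leaf to the path itself and three to repeated colours.\<close>

locale pendant_K4 =
  fixes K L :: "'a set" and par :: "'a \<Rightarrow> 'a"
  assumes K: "card K = 4" and L: "finite L" "K \<inter> L = {}" "par ` L \<subseteq> K"
    and L_large: "\<And>v. v \<in> K \<Longrightarrow> 4 < card {x \<in> L. par x = v}"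
begin

definition E :: "'a set set" where
  "E = {e. e \<subseteq> K \<and> card e = 2} \<union> (\<lambda>x. {x, par x}) ` L"

lemma finite_K: "finite K"
  using K by (metis card.infinite zero_neq_numeral)

lemma K_edge: "u \<in> K \<Longrightarrow> v \<in> K \<Longrightarrow> u \<noteq> v \<Longrightarrow> {u, v} \<in> E"
  by (auto simp: E_def)

lemma L_edge: "x \<in> L \<Longrightarrow> {x, par x} \<in> E"
  by (auto simp: E_def)

lemma par_K: "x \<in> L \<Longrightarrow> par x \<in> K"
  using L(3) by auto

lemma par_notin_L: "x \<in> L \<Longrightarrow> par x \<notin> L"
  using L(2) par_K by blast

lemma simple: "simple_graph (K \<union> L, E)"
proof -
  have "e \<subseteq> K \<union> L \<and> card e = 2" if "e \<in> E" for e
    using that L par_K unfolding E_def by (fastforce simp: card_2_iff)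
  then show ?thesis using finite_K L(1) by (simp add: simple_graph_def)
qed

lemma leaf_edge: "{x, y} \<in> E \<Longrightarrow> x \<in> L \<Longrightarrow> y = par x"
  using L(2) par_notin_L[of y] unfolding E_def by (auto simp: doubleton_eq_iff)

text \<open>The four interior vertices of a path on six vertices are not leaves, so they exhaust
  \<open>K\<close>; its second and fourth edges are then opposite edges of the
  \<open>K\<^sub>4\<close>.\<close>

lemma no_rainbow:
  assumes c: "\<And>u v w t. {u, v, w, t} = K \<Longrightarrow> c {u, v} = c {w, t}"
  shows "rainbow_free 6 E c"
  unfolding rainbow_free_def
proof
  assume "\<exists>p. length p = 6 \<and> rainbow_path E c p"
  then obtain p where p: "length p = 6" "rainbow_path E c p" by blast
  then obtain a u v w t b where p_eq: "p = [a, u, v, w, t, b]"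
    by (auto simp: numeral_eq_Suc length_Suc_conv)
  have d: "distinct p" and e: "set (path_edges p) \<subseteq> E" using p(2) by (auto simp: rainbow_path_def)
  have inner: "p ! i \<in> K" if "i \<in> {1, 2, 3, 4}" for i
  proof -
    have i: "0 < i" "Suc i < length p" using that p(1) by auto
    have "{p ! i, p ! Suc i} \<in> E" using e i by (auto simp: path_edges_conv_nth)
    then have "p ! i \<in> K \<union> L" using simple by (auto simp: simple_graph_def)
    moreover have "p ! i \<notin> L" using path_interior_not_leaf[OF d e i] leaf_edge by metis
    ultimately show ?thesis by blast
  qed
  have "{u, v, w, t} \<subseteq> K"
    using inner[of 1] inner[of 2] inner[of 3] inner[of 4] by (auto simp: p_eq)
  moreover have "card {u, v, w, t} = card K" using d K by (simp add: p_eq)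
  ultimately have "{u, v, w, t} = K" using finite_K by (simp add: card_subset_eq)
  then have "c {u, v} = c {w, t}" by (rule c)
  then show False using p(2) by (simp add: p_eq rainbow_path_def)
qed

lemma append_leaf:
  assumes c: "proper E' c" "E \<subseteq> E'" and p: "rainbow_path E' c (q @ [v])"
    and v: "v \<in> K" and q: "card ({x \<in> L. par x = v} \<inter> set q) + (length q - 1) \<le> 4"
  obtains x where "x \<in> L" "par x = v" "rainbow_path E' c (q @ [v, x])"
proof -
  obtain x where "x \<in> {x \<in> L. par x = v}" "rainbow_path E' c (q @ [v, x])"
  proof (rule extend_path[OF c(1) p(1), of "{x \<in> L. par x = v}"])
    show "card ({x \<in> L. par x = v} \<inter> set q) + (length q - 1) < card {x \<in> L. par x = v}"
      using L_large[OF v] q by linarith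
  qed (use L L_edge c(2) v in \<open>auto simp: insert_commute\<close>)
  then show ?thesis using that by blast
qed

text \<open>Otherwise the path u, v, w, t is rainbow, and there are enough leaves at both ends to
  prolong it to a rainbow path on six vertices.\<close>

lemma opposite_edges:
  assumes c: "proper E' c" "E \<subseteq> E'" "rainbow_free 6 E' c" and K_eq: "{u, v, w, t} = K"
  shows "c {u, v} = c {w, t}"
proof (rule ccontr)
  assume ne: "c {u, v} \<noteq> c {w, t}"
  have d: "distinct [u, v, w, t]"
    using K K_eq by (intro card_distinct) simp
  have in_K: "u \<in> K" "v \<in> K" "w \<in> K" "t \<in> K" using K_eq by auto
  have e: "{u, v} \<in> E'" "{v, w} \<in> E'" "{w, t} \<in> E'"
    using d in_K K_edge c(2) by auto
  have "c {v, u} \<noteq> c {v, w}" "c {w, v} \<noteq> c {w, t}"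
    using proper_neq[OF c(1), of v u w] proper_neq[OF c(1), of w v t] e d
    by (auto simp: insert_commute)
  then have "rainbow_path E' c ([u, v, w] @ [t])"
    using ne d e by (auto simp: rainbow_path_def insert_commute)
  moreover have disj: "{x \<in> L. par x = t} \<inter> set [u, v, w] = {}" using in_K L by auto
  ultimately obtain x where x: "x \<in> L" "par x = t" "rainbow_path E' c ([u, v, w] @ [t, x])"
    using append_leaf[OF c(1,2), of "[u, v, w]" t] in_K by auto
  then have "rainbow_path E' c ([x, t, w, v] @ [u])"
    using rainbow_path_rev[of E' c "[u, v, w] @ [t, x]"] by simp
  moreover have "{x \<in> L. par x = u} \<inter> set [x, t, w, v] = {}" using in_K L d x by auto
  ultimately obtain y where "rainbow_path E' c ([x, t, w, v] @ [u, y])"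
    using append_leaf[OF c(1,2), of "[x, t, w, v]" u] in_K by auto
  then show False using c(3) unfolding rainbow_free_def by (auto dest!: spec[of _ "[x, t, w, v, u, y]"])
qed

text \<open>All pairs inside \<open>K\<close> are edges, so the new edge joins a leaf
  \<open>x\<close> to some \<open>z\<close>. With v the parent of \<open>x\<close> and u, w, t the
  rest of \<open>K\<close>, the path z, x, v, u, w and a leaf at w is sought. The edge u w has the
  colour of v t, so only clashes of the new edge with v u and v t have to be avoided.\<close>

lemma forced:
  assumes e: "e \<in> non_edges (K \<union> L, E)" and c: "proper (insert e E) c"
  shows "\<not> rainbow_free 6 (insert e E) c"
proof
  let ?E = "insert e E"
  assume free: "rainbow_free 6 ?E c"
  have eV: "e \<subseteq> K \<union> L" "card e = 2" "e \<notin> E" using e by (auto simp: non_edges_def)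
  then obtain x where x: "x \<in> e" "x \<in> L" by (auto simp: E_def)
  then obtain z where z: "e = {x, z}" "z \<noteq> x" using eV(2) by (auto simp: card_2_iff)
  let ?v = "par x"
  have v: "?v \<in> K" "x \<noteq> ?v" using par_K[OF x(2)] par_notin_L[OF x(2)] x(2) by auto
  have zv: "z \<noteq> ?v" using L_edge[OF x(2)] eV z by auto
  have xv: "{x, ?v} \<in> ?E" using L_edge[OF x(2)] by simp
  have xz: "{x, z} \<in> ?E" using z by simp
  \<comment> \<open>The vertex \<open>w\<close> absorbs the possible clash. If \<open>z\<close> is
    in \<open>K\<close>, no edge from \<open>?v\<close> into \<open>K\<close> has the colour of the
    new edge, since that edge or its opposite meets \<open>z\<close>. If not, at most one such edge
    has it, and \<open>w\<close> is taken as its end.\<close>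
  have "\<exists>w\<in>K - {?v, z}. \<forall>y\<in>K - {?v, w}. c {?v, y} \<noteq> c {x, z}"
  proof (cases "z \<in> K")
    case True
    have "c {?v, y} \<noteq> c {x, z}" if y: "y \<in> K - {?v}" for y
    proof (cases "y = z")
      case True
      then show ?thesis
        using proper_neq[OF c, of z ?v x] K_edge[of ?v z] v y xz x L(2) by (auto simp: insert_commute)
    next
      case False
      have "card (K - {?v, y, z}) = 1"
        using False y zv v True K finite_K by (subst card_Diff_subset) auto
      then obtain w where "K - {?v, y, z} = {w}" by (auto simp: card_1_singleton_iff)
      then have w: "w \<in> K" "w \<noteq> ?v" "w \<noteq> y" "w \<noteq> z" "{?v, y, w, z} = K" using y v True by auto
      have "c {?v, y} = c {w, z}" using opposite_edges[OF c _ free w(5)] by auto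
      also have "\<dots> \<noteq> c {x, z}"
        using proper_neq[OF c, of z w x] K_edge[of w z] w True xz x L(2) by (auto simp: insert_commute)
      finally show ?thesis .
    qed
    moreover have "card (K - {?v, z}) = 2" using zv v True K finite_K by (subst card_Diff_subset) auto
    then have "K - {?v, z} \<noteq> {}" by (metis card.empty zero_neq_numeral)
    ultimately show ?thesis by blast
  next
    case False
    show ?thesis
    proof (cases "\<exists>w\<in>K - {?v}. c {?v, w} = c {x, z}")
      case True
      then obtain w where w: "w \<in> K - {?v}" "c {?v, w} = c {x, z}" by blast
      have "c {?v, y} \<noteq> c {x, z}" if "y \<in> K - {?v, w}" for y
        using proper_neq[OF c, of ?v y w] K_edge[of ?v y] K_edge[of ?v w] that w v by auto
      then show ?thesis using w False by blast
    next
      case no: False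
      have "K - {?v, z} = K - {?v}" using False by auto
      then have "card (K - {?v, z}) = 3" using v K finite_K by (simp add: card_Diff_singleton)
      then have "K - {?v, z} \<noteq> {}" by (metis card.empty zero_neq_numeral)
      then show ?thesis using no False by blast
    qed
  qed
  then obtain w where w: "w \<in> K" "w \<noteq> ?v" "w \<noteq> z"
    "\<And>y. y \<in> K - {?v, w} \<Longrightarrow> c {?v, y} \<noteq> c {x, z}" by blast
  have "card (K - {?v, w}) = 2" using K w v finite_K by (subst card_Diff_subset) auto
  then obtain u t where ut: "K - {?v, w} = {u, t}" "u \<noteq> t" "u \<noteq> z"
    unfolding card_2_iff by (metis insert_commute)
  have in_K: "u \<in> K" "u \<noteq> ?v" "u \<noteq> w" "t \<in> K" "t \<noteq> ?v" using ut by auto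
  have "{u, w, ?v, t} = K" using ut w(1) v(1) by auto
  then have opp: "c {u, w} = c {?v, t}" using opposite_edges[OF c _ free] by auto
  have e: "{?v, u} \<in> ?E" "{?v, t} \<in> ?E" "{u, w} \<in> ?E" using K_edge in_K v w by auto
  have vx: "{?v, x} \<in> ?E" using xv by (simp add: insert_commute)
  have notL: "u \<notin> L" "t \<notin> L" "w \<notin> L" using in_K w L by auto
  have "c {x, ?v} \<noteq> c {?v, u}" "c {x, ?v} \<noteq> c {?v, t}" "c {?v, u} \<noteq> c {?v, t}"
    "c {x, z} \<noteq> c {x, ?v}" "c {x, z} \<noteq> c {?v, u}" "c {x, z} \<noteq> c {?v, t}"
    using proper_neq[OF c vx e(1)] proper_neq[OF c vx e(2)] proper_neq[OF c e(1,2)]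
      proper_neq[OF c xz xv] zv ut notL x w(4)[of u] w(4)[of t] by (auto simp: insert_commute)
  then have "rainbow_path ?E c ([z, x, ?v, u] @ [w])"
    using e xz xv opp v z(2) zv ut w in_K notL x
    by (auto simp: rainbow_path_def insert_commute[of z x])
  moreover have "{y \<in> L. par y = w} \<inter> set [z, x, ?v, u] \<subseteq> {z}" using w v notL L by auto
  then have "card ({y \<in> L. par y = w} \<inter> set [z, x, ?v, u]) \<le> card {z}" by (intro card_mono) auto
  ultimately obtain y where "rainbow_path ?E c ([z, x, ?v, u] @ [w, y])"
    using append_leaf[OF c _, of "[z, x, ?v, u]" w] w(1) by auto
  then show False using free unfolding rainbow_free_def by (auto dest!: spec[of _ "[z, x, ?v, u, w, y]"])
qed

lemma card_E: "card E = 6 + card L"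
proof -
  have "inj_on (\<lambda>x. {x, par x}) L"
    using L par_K by (fastforce simp: inj_on_def doubleton_eq_iff)
  then have 1: "card ((\<lambda>x. {x, par x}) ` L) = card L" by (rule card_image)
  have 2: "card {e. e \<subseteq> K \<and> card e = 2} = 6"
    using n_subsets[OF finite_K, of 2] K by (simp add: choose_two)
  have "{e. e \<subseteq> K \<and> card e = 2} \<inter> (\<lambda>x. {x, par x}) ` L = {}" using L by auto
  then show ?thesis
    unfolding E_def using L(1) finite_K 1 2 by (subst card_Un_disjoint) auto
qed

end

text \<open>On the central \<open>K\<^sub>4\<close> with vertices 0, 1, 2, 3 disjoint edges have vertex sums adding up to 6,
  so the colour \<open>min s (6 - s)\<close> of an edge with vertex sum \<open>s\<close> is constant on perfect matchings.\<close>

lemma sat_star_path_6: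
  assumes "n \<ge> 28"
  shows "sat_star n (path_graph 6) \<le> n + 2"
proof -
  let ?K = "{..<4 :: nat}"
  let ?L = "{4..<n}"
  let ?par = "\<lambda>x :: nat. x mod 4"
  interpret pendant_K4 ?K ?L ?par
  proof
    show "4 < card {x \<in> ?L. ?par x = v}" if v: "v \<in> ?K" for v
    proof -
      \<comment> \<open>Six leaves at each vertex; the largest one needed is 27, which is why 28
        vertices suffice.\<close>
      have "(\<lambda>j. j * 4 + (v + 4)) ` {..<6} \<subseteq> {x \<in> ?L. ?par x = v}"
        using assms v by auto
      then have "card ((\<lambda>j. j * 4 + (v + 4)) ` {..<6}) \<le> card {x \<in> ?L. ?par x = v}"
        by (intro card_mono) auto
      then show ?thesis by (subst (asm) card_image) (auto simp: inj_on_def)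
    qed
  qed auto
  \<comment> \<open>A pendant edge takes its leaf as colour, hence at least 4, while the edges of
    the \<open>K\<^sub>4\<close> use only 1, 2 and 3.\<close>
  define c :: "nat set \<Rightarrow> nat" where
    "c e = (if e \<subseteq> ?K then min (\<Sum>e) (6 - \<Sum>e) else Max e)" for e
  have core: "c {u, v} = min (u + v) (6 - (u + v))" if "u < 4" "v < 4" "u \<noteq> v" for u v
    using that by (simp add: c_def)
  have leaf: "c {x, ?par x} = x" if "x \<in> ?L" for x
    using that mod_less_eq_dividend[of x 4] by (simp add: c_def max_absorb1)
  have E_cases: "e \<subseteq> ?K \<and> c e < 4 \<or> (\<exists>x\<in>?L. e = {x, ?par x})" if e: "e \<in> E" for e
  proof -
    from e consider "e \<subseteq> ?K" "card e = 2" | "\<exists>x\<in>?L. e = {x, ?par x}" by (auto simp: E_def)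
    then show ?thesis
    proof cases
      case 1
      then obtain u v where uv: "e = {u, v}" "u \<noteq> v" by (auto simp: card_2_iff)
      then have "c e < 4" using core[of u v] 1 by auto
      then show ?thesis using 1 by blast
    qed blast
  qed
  have "proper E c"
    unfolding proper_def
  proof (intro ballI impI)
    fix e e' assume ee: "e \<in> E" "e' \<in> E" "e \<noteq> e' \<and> e \<inter> e' \<noteq> {}"
    show "c e \<noteq> c e'"
    proof (cases "e \<subseteq> ?K \<and> e' \<subseteq> ?K")
      case True
      obtain u where u: "u \<in> e" "u \<in> e'" using ee(3) by blast
      obtain v where v: "v \<in> nbrs E u" "e = {u, v}" using edge_at[OF simple ee(1) u(1)] .
      obtain w where w: "w \<in> nbrs E u" "e' = {u, w}" using edge_at[OF simple ee(2) u(2)] .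
      have d: "u \<noteq> v" "u \<noteq> w" "v \<noteq> w"
        using nbrs_irrefl[OF simple, of u] v w ee(3) by auto
      have "u < 4" "v < 4" "w < 4" using True v w by auto
      then have "u \<in> {0, 1, 2, 3}" "v \<in> {0, 1, 2, 3}" "w \<in> {0, 1, 2, 3}" by auto
      then show ?thesis using d core[of u v] core[of u w] unfolding v(2) w(2) by auto
    next
      case False
      then show ?thesis using E_cases[OF ee(1)] E_cases[OF ee(2)] ee(3) leaf by fastforce
    qed
  qed
  moreover have "rainbow_free 6 E c"
  proof (rule no_rainbow)
    fix u v w t assume K_eq: "{u, v, w, t} = ?K"
    have d: "distinct [u, v, w, t]" using K_eq by (intro card_distinct) simp
    have in_K: "u \<in> ?K" "v \<in> ?K" "w \<in> ?K" "t \<in> ?K" unfolding K_eq[symmetric] by simp_all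
    have sum: "u + v + w + t = 6"
    proof -
      have "u + v + w + t = \<Sum>{u, v, w, t}" using d by simp
      also have "\<dots> = 6" unfolding K_eq by (simp add: numeral_eq_Suc)
      finally show ?thesis .
    qed
    have "6 - (u + v) = w + t" "6 - (w + t) = u + v" using sum by linarith+
    moreover have "c {u, v} = min (u + v) (6 - (u + v))" "c {w, t} = min (w + t) (6 - (w + t))"
      using in_K d by (auto intro!: core)
    ultimately show "c {u, v} = c {w, t}" by (simp only: min.commute)
  qed
  moreover have "card (?K \<union> ?L) = n" using assms by (subst card_Un_disjoint) auto
  ultimately have "sat_star n (path_graph 6) \<le> card E + card ({} :: nat set set)"
    using forced by (intro sat_star_path_le[OF simple]) auto
  then show ?thesis using card_E assms by simp
qed

section \<open>Paths on five vertices\<close>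

text \<open>A triangle with two pendant edges at each vertex. Without a rainbow \<open>P\<^sub>5\<close> its colouring is
  unique: one pendant edge at each vertex repeats the colour of the opposite side, and the
  other three have a common fourth colour.\<close>

locale coloured_triangle =
  fixes E :: "'a set set" and c and A B C a a' b b' d d' :: 'a
  assumes c: "proper E c" "rainbow_free 5 E c"
    and dist: "distinct [A, B, C, a, a', b, b', d, d']"
    and edges: "{A, B} \<in> E" "{A, C} \<in> E" "{B, C} \<in> E" "{A, a} \<in> E" "{A, a'} \<in> E"
      "{B, b} \<in> E" "{B, b'} \<in> E" "{C, d} \<in> E" "{C, d'} \<in> E"
    and cols: "c {A, a} = c {B, C}" "c {B, b} = c {A, C}" "c {C, d} = c {A, B}"
      "c {B, b'} = c {A, a'}" "c {C, d'} = c {A, a'}"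
begin

text \<open>The configuration is symmetric in its three corners. This exchange and the next generate
  all permutations, so only new edges at \<open>A\<close>, \<open>a\<close> and \<open>a'\<close>
  need a direct argument.\<close>

lemma swap_BC: "coloured_triangle E c A C B a a' d d' b b'"
  using c dist edges cols by unfold_locales (auto simp: insert_commute)

lemma swap_AB: "coloured_triangle E c B A C b b' a a' d d'"
  using c dist edges cols by unfold_locales (auto simp: insert_commute)

definition path5 :: "'a \<Rightarrow> 'a \<Rightarrow> 'a \<Rightarrow> 'a \<Rightarrow> 'a \<Rightarrow> bool" where
  "path5 p q r s t \<longleftrightarrow> distinct [p, q, r, s, t] \<and>
    {p, q} \<in> E \<and> {q, r} \<in> E \<and> {r, s} \<in> E \<and> {s, t} \<in> E \<and>
    distinct [c {p, q}, c {q, r}, c {r, s}, c {s, t}]"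

lemma no_path5: "\<not> path5 p q r s t"
  using c(2) unfolding rainbow_free_def path5_def
  by (auto simp: rainbow_path_def dest!: spec[of _ "[p, q, r, s, t]"])

lemma comm: "{B, A} = {A, B}" "{C, A} = {A, C}" "{C, B} = {B, C}" "{a, A} = {A, a}"
  "{a', A} = {A, a'}" "{b, B} = {B, b}" "{b', B} = {B, b'}" "{d, C} = {C, d}" "{d', C} = {C, d'}"
  by auto

lemma distinct_colours: "distinct [c {B, C}, c {A, C}, c {A, B}, c {A, a'}]"
  using proper_neq[OF c(1), of A B C] proper_neq[OF c(1), of B A C] proper_neq[OF c(1), of C A B]
    proper_neq[OF c(1), of A a a'] proper_neq[OF c(1), of A B a'] proper_neq[OF c(1), of A C a']
    dist edges cols
  by (simp add: comm)

text \<open>All four colours of the configuration occur at \<open>A\<close>, so the new edge has a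
  fifth one. It continues along two sides and a pendant edge of the fourth colour; the second path
  serves when \<open>z\<close> is the end of the first.\<close>

lemma no_edge_A:
  assumes e: "{z, A} \<in> E" and z: "z \<notin> {A, B, C, a, a'}"
  shows False
proof -
  have e': "{A, z} \<in> E" using e by (simp add: insert_commute)
  have "c {z, A} \<notin> {c {A, B}, c {A, C}, c {B, C}, c {A, a'}}"
    using proper_neq[OF c(1) e', of B] proper_neq[OF c(1) e', of C] proper_neq[OF c(1) e', of a]
      proper_neq[OF c(1) e', of a'] z edges cols by (auto simp: insert_commute[of z A])
  then show False
    using no_path5[of z A B C d'] no_path5[of z A C B b'] z e dist edges cols distinct_colours
    by (auto simp: path5_def comm)
qed

text \<open>The edge \<open>{A, a}\<close> repeats the colour of \<open>{B, C}\<close>, so paths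
  from \<open>z\<close> through \<open>a\<close> and \<open>A\<close> go on along another side and a
  pendant edge. Most of them end at \<open>C\<close>; the excluded \<open>z\<close> around
  \<open>C\<close> are covered by exchanging \<open>B\<close> and \<open>C\<close>.\<close>

lemma no_edge_a:
  assumes e: "{z, a} \<in> E" and z: "z \<notin> {A, a, C, d, d'}"
  shows False
proof -
  have e': "{a, z} \<in> E" using e by (simp add: insert_commute)
  have q: "c {z, a} \<noteq> c {B, C}"
    using proper_neq[OF c(1) e', of A] z edges cols by (auto simp: insert_commute[of z a] comm)
  show False
  proof (cases "z = B")
    case True
    have "c {B, a} \<notin> {c {A, B}, c {A, C}, c {B, C}, c {A, a'}}"
      using proper_neq[OF c(1), of B a A] proper_neq[OF c(1), of B a C]
        proper_neq[OF c(1), of B a b] proper_neq[OF c(1), of B a b'] e True dist edges cols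
      by (auto simp: comm)
    then show ?thesis
      using no_path5[of a B C A a'] True e e' dist edges cols distinct_colours
      by (auto simp: path5_def comm insert_commute[of a B])
  next
    case zB: False
    show ?thesis
    proof (cases "z = b \<or> z = b'")
      case True
      have "c {z, a} \<noteq> c {B, z}"
        using proper_neq[OF c(1), of z a B] True e dist edges by (auto simp: comm)
      \<comment> \<open>Both paths through \<open>C\<close> leave only the colour of
        \<open>{A, C}\<close>. It already occurs at \<open>b\<close>, so \<open>z\<close> is
        \<open>b'\<close>, and a path starting with \<open>a\<close>, \<open>b'\<close>,
        \<open>B\<close> is rainbow.\<close>
      have "c {z, a} \<in> {c {A, C}, c {A, a'}}"
        using no_path5[of z a A C d'] True q e dist edges cols distinct_colours
        by (auto simp: path5_def comm)
      moreover have "c {z, a} \<in> {c {A, C}, c {A, B}}"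
        using no_path5[of z a A C d] True q e dist edges cols distinct_colours
        by (auto simp: path5_def comm)
      ultimately have AC: "c {z, a} = c {A, C}" using distinct_colours by auto
      then have "z = b'" using True \<open>c {z, a} \<noteq> c {B, z}\<close> cols by auto
      then show ?thesis
        using no_path5[of a b' B C d] AC e e' dist edges cols distinct_colours
        by (auto simp: path5_def comm insert_commute[of a b'])
    next
      case False
      \<comment> \<open>Each path that fails to be rainbow confines the new colour to two values;
        the three pairs have no common element.\<close>
      have "c {z, a} \<in> {c {A, C}, c {A, a'}}"
        using no_path5[of z a A C d'] z q e dist edges cols distinct_colours
        by (auto simp: path5_def comm)
      moreover have "c {z, a} \<in> {c {A, B}, c {A, a'}}"
        using no_path5[of z a A B b'] z zB False q e dist edges cols distinct_colours
        by (auto simp: path5_def comm)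
      moreover have "c {z, a} \<in> {c {A, B}, c {A, C}}"
        using no_path5[of z a A B b] z zB False q e dist edges cols distinct_colours
        by (auto simp: path5_def comm)
      ultimately show ?thesis using distinct_colours by auto
    qed
  qed
qed

text \<open>Here the edge \<open>{A, a'}\<close> has the fourth colour. Apart from
  \<open>z = B\<close>, three paths confine the new colour to three different pairs of side colours,
  and these have no common element.\<close>

lemma no_edge_a':
  assumes e: "{z, a'} \<in> E" and z: "z \<notin> {A, a', C, d, d'}"
  shows False
proof -
  have e': "{a', z} \<in> E" using e by (simp add: insert_commute)
  have q: "c {z, a'} \<noteq> c {A, a'}"
    using proper_neq[OF c(1) e', of A] z edges cols by (auto simp: insert_commute[of z a'] comm)
  show False
  proof (cases "z = B")
    case True
    have "c {B, a'} \<notin> {c {A, B}, c {A, C}, c {B, C}, c {A, a'}}"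
      using proper_neq[OF c(1), of B a' A] proper_neq[OF c(1), of B a' C]
        proper_neq[OF c(1), of B a' b] proper_neq[OF c(1), of B a' b'] e True dist edges cols
      by (auto simp: comm)
    then show ?thesis
      using no_path5[of a' B A C d'] True e e' dist edges cols distinct_colours
      by (auto simp: path5_def comm insert_commute[of a' B])
  next
    case zB: False
    show ?thesis
      using no_path5[of z a' A B C] no_path5[of z a' A C B] no_path5[of z a' A C d]
        z zB q e dist edges cols distinct_colours
      by (auto simp: path5_def comm)
  qed
qed

text \<open>The vertex \<open>z\<close> cannot belong to both the \<open>B\<close> side and the
  \<open>C\<close> side, so one of the two orientations applies.\<close>

lemma no_edge_family_A:
  assumes "u \<in> {A, a, a'}" "{z, u} \<in> E" "z \<noteq> u"
    "{z, u} \<notin> {{A, B}, {A, C}, {B, C}, {A, a}, {A, a'}, {B, b}, {B, b'}, {C, d}, {C, d'}}"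
  shows False
proof -
  interpret BC: coloured_triangle E c A C B a a' d d' b b' by (rule swap_BC)
  from assms(1) consider "u = A" | "u = a" | "u = a'" by blast
  then show False
  proof cases
    case 1
    have "z \<noteq> A" "{z, A} \<notin> {{A, B}, {A, C}, {A, a}, {A, a'}}" using assms(3,4) 1 by simp_all
    then have "z \<notin> {A, B, C, a, a'}" by (metis insertCI insert_commute insertE singletonD)
    then show False using no_edge_A assms(2) 1 by blast
  next
    case 2
    have "z \<noteq> a" "{z, a} \<noteq> {A, a}" using assms(3,4) 2 by simp_all
    then have "z \<notin> {A, a}" by blast
    moreover have "z \<notin> {C, d, d'} \<or> z \<notin> {B, b, b'}" using dist by auto
    ultimately show False using no_edge_a[of z] BC.no_edge_a[of z] assms(2) 2 by blast
  next
    case 3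
    have "z \<noteq> a'" "{z, a'} \<noteq> {A, a'}" using assms(3,4) 3 by simp_all
    then have "z \<notin> {A, a'}" by blast
    moreover have "z \<notin> {C, d, d'} \<or> z \<notin> {B, b, b'}" using dist by auto
    ultimately show False using no_edge_a'[of z] BC.no_edge_a'[of z] assms(2) 3 by blast
  qed
qed

end

lemma no_edge_coloured_triangle:
  assumes "coloured_triangle E c A B C a a' b b' d d'"
    and "u \<in> {A, B, C, a, a', b, b', d, d'}" "{z, u} \<in> E" "z \<noteq> u"
    "{z, u} \<notin> {{A, B}, {A, C}, {B, C}, {A, a}, {A, a'}, {B, b}, {B, b'}, {C, d}, {C, d'}}"
  shows False
proof -
  interpret coloured_triangle E c A B C a a' b b' d d' by fact
  interpret AB: coloured_triangle E c B A C b b' a a' d d' by (rule swap_AB)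
  interpret BC: coloured_triangle E c A C B a a' d d' b b' by (rule swap_BC)
  interpret CA: coloured_triangle E c C A B d d' a a' b b' by (rule BC.swap_AB)
  consider "u \<in> {A, a, a'}" | "u \<in> {B, b, b'}" | "u \<in> {C, d, d'}" using assms(2) by blast
  then show False
  proof cases
    case 1
    then show False using no_edge_family_A[OF _ assms(3-5)] by blast
  next
    case 2
    then show False using AB.no_edge_family_A[OF _ assms(3,4)] assms(5) by (simp add: comm)
  next
    case 3
    then show False using CA.no_edge_family_A[OF _ assms(3,4)] assms(5) by (simp add: comm)
  qed
qed

text \<open>Of the two pendant edges at a corner, at least one avoids the colour of the opposite
  side; it is called primed. A path x, X, Z, Y, y that is not rainbow repeats a colour on
  non-adjacent edges. For two primed edges this means that they agree. An unprimed edge, compared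
  with a primed one elsewhere, must repeat its opposite side, since it differs from the primed edge
  at its own corner.\<close>

lemma coloured_triangle_exists:
  assumes c: "proper E c" "rainbow_free 5 E c"
    and dist: "distinct [A, B, C, a1, a2, b1, b2, d1, d2]"
    and edges: "{A, B} \<in> E" "{A, C} \<in> E" "{B, C} \<in> E" "{A, a1} \<in> E" "{A, a2} \<in> E"
      "{B, b1} \<in> E" "{B, b2} \<in> E" "{C, d1} \<in> E" "{C, d2} \<in> E"
  obtains a a' b b' d d' where "coloured_triangle E c A B C a a' b b' d d'"
    "{a, a'} = {a1, a2}" "{b, b'} = {b1, b2}" "{d, d'} = {d1, d2}"
proof -
  have no: False if "distinct [p, q, r, s, t]" "{p, q} \<in> E" "{q, r} \<in> E" "{r, s} \<in> E" "{s, t} \<in> E"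
    "distinct [c {p, q}, c {q, r}, c {r, s}, c {s, t}]" for p q r s t
    using c(2) that unfolding rainbow_free_def
    by (auto simp: rainbow_path_def dest!: spec[of _ "[p, q, r, s, t]"])
  have common: "c {X, x} = c {Y, Z} \<or> c {Y, y} = c {X, Z} \<or> c {X, x} = c {Y, y}"
    if "distinct [x, X, Z, Y, y]" "{X, x} \<in> E" "{X, Z} \<in> E" "{Y, Z} \<in> E" "{Y, y} \<in> E" for x X Z Y y
  proof -
    have e: "{x, X} \<in> E" "{Z, X} \<in> E" "{Z, Y} \<in> E"
      using that by (simp_all add: insert_commute)
    have "c {X, x} \<noteq> c {X, Z}" "c {Z, X} \<noteq> c {Z, Y}" "c {Y, Z} \<noteq> c {Y, y}"
      using proper_neq[OF c(1) that(2,3)] proper_neq[OF c(1) e(2,3)] proper_neq[OF c(1) that(4,5)]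
        that(1) by auto
    then show ?thesis
      using no[OF that(1) e(1) that(3) e(3) that(5)] insert_commute[of x X "{}"]
        insert_commute[of Z X "{}"] insert_commute[of Z Y "{}"] by fastforce
  qed
  have other: "\<exists>x x'. {x, x'} = {x1, x2} \<and> {X, x} \<in> E \<and> {X, x'} \<in> E \<and> x \<noteq> x' \<and> c {X, x'} \<noteq> k"
    if "x1 \<noteq> x2" "{X, x1} \<in> E" "{X, x2} \<in> E" for X x1 x2 k
  proof (cases "c {X, x2} = k")
    case True
    then have "c {X, x1} \<noteq> k" using proper_neq[OF c(1) that(2,3,1)] by simp
    then show ?thesis using that by (intro exI[of _ x2] exI[of _ x1]) auto
  next
    case False
    then show ?thesis using that by (intro exI[of _ x1] exI[of _ x2]) auto
  qed
  have ne: "a1 \<noteq> a2" "b1 \<noteq> b2" "d1 \<noteq> d2" using dist by auto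
  obtain a a' where a: "{a, a'} = {a1, a2}" "{A, a} \<in> E" "{A, a'} \<in> E" "a \<noteq> a'" "c {A, a'} \<noteq> c {B, C}"
    using other[OF ne(1) edges(4,5), of "c {B, C}"] by blast
  obtain b b' where b: "{b, b'} = {b1, b2}" "{B, b} \<in> E" "{B, b'} \<in> E" "b \<noteq> b'" "c {B, b'} \<noteq> c {A, C}"
    using other[OF ne(2) edges(6,7), of "c {A, C}"] by blast
  obtain d d' where d: "{d, d'} = {d1, d2}" "{C, d} \<in> E" "{C, d'} \<in> E" "d \<noteq> d'" "c {C, d'} \<noteq> c {A, B}"
    using other[OF ne(3) edges(8,9), of "c {A, B}"] by blast
  have D: "distinct [A, B, C, a, a', b, b', d, d']"
    using dist a(1) b(1) d(1) by (auto simp: doubleton_eq_iff)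
  have rev: "{B, A} = {A, B}" "{C, A} = {A, C}" "{C, B} = {B, C}" by auto
  have AB: "c {A, x} = c {B, C} \<or> c {B, y} = c {A, C} \<or> c {A, x} = c {B, y}"
    if "x \<in> {a, a'}" "y \<in> {b, b'}" for x y
  proof (rule common[of x A C B y, unfolded rev])
    show "distinct [x, A, C, B, y]" "{A, x} \<in> E" "{B, y} \<in> E" using that D a(2,3) b(2,3) by auto
  qed (use edges in auto)
  have AC: "c {A, x} = c {B, C} \<or> c {C, y} = c {A, B} \<or> c {A, x} = c {C, y}"
    if "x \<in> {a, a'}" "y \<in> {d, d'}" for x y
  proof (rule common[of x A B C y, unfolded rev])
    show "distinct [x, A, B, C, y]" "{A, x} \<in> E" "{C, y} \<in> E" using that D a(2,3) d(2,3) by auto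
  qed (use edges in auto)
  have eqs: "c {B, b'} = c {A, a'}" "c {C, d'} = c {A, a'}"
    using AB[of a' b'] AC[of a' d'] a(5) b(5) d(5) by auto
  have "c {A, a} = c {B, C}"
    using AB[of a b'] b(5) eqs proper_neq[OF c(1) a(2,3,4)] by simp
  moreover have "c {B, b} = c {A, C}"
    using AB[of a' b] a(5) eqs proper_neq[OF c(1) b(2,3,4)] by simp
  moreover have "c {C, d} = c {A, B}"
    using AC[of a' d] a(5) eqs proper_neq[OF c(1) d(2,3,4)] by simp
  ultimately have "coloured_triangle E c A B C a a' b b' d d'"
    using c D edges(1-3) a(2,3) b(2,3) d(2,3) eqs by unfold_locales
  then show thesis using that[OF _ a(1) b(1) d(1)] by simp
qed

lemma triangle_forced:
  assumes c: "proper E c"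
    and dist: "distinct [A, B, C, a1, a2, b1, b2, d1, d2]"
    and edges: "{{A, B}, {A, C}, {B, C}, {A, a1}, {A, a2}, {B, b1}, {B, b2}, {C, d1}, {C, d2}} \<subseteq> E"
    and u: "u \<in> {A, B, C, a1, a2, b1, b2, d1, d2}" "{z, u} \<in> E" "z \<noteq> u"
      "{z, u} \<notin> {{A, B}, {A, C}, {B, C}, {A, a1}, {A, a2}, {B, b1}, {B, b2}, {C, d1}, {C, d2}}"
  shows "\<not> rainbow_free 5 E c"
proof
  assume free: "rainbow_free 5 E c"
  obtain a a' b b' d d' where t: "coloured_triangle E c A B C a a' b b' d d'"
    "{a, a'} = {a1, a2}" "{b, b'} = {b1, b2}" "{d, d'} = {d1, d2}"
    by (rule coloured_triangle_exists[OF c free dist]) (use edges in auto)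
  have "u \<in> {A, B, C} \<union> {a, a'} \<union> {b, b'} \<union> {d, d'}" unfolding t(2-4) using u(1) by auto
  then have u': "u \<in> {A, B, C, a, a', b, b', d, d'}" by auto
  have sub: "{{A, B}, {A, C}, {B, C}, {A, a}, {A, a'}, {B, b}, {B, b'}, {C, d}, {C, d'}} \<subseteq>
      {{A, B}, {A, C}, {B, C}, {A, a1}, {A, a2}, {B, b1}, {B, b2}, {C, d1}, {C, d2}}"
    using t(2-4) by (auto simp: doubleton_eq_iff)
  have "{z, u} \<notin> {{A, B}, {A, C}, {B, C}, {A, a}, {A, a'}, {B, b}, {B, b'}, {C, d}, {C, d'}}"
    by (rule contra_subsetD[OF sub u(4)])
  then show False by (rule no_edge_coloured_triangle[OF t(1) u' u(2,3)])
qed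

section \<open>Disjoint triangles with pendant edges\<close>

text \<open>The corners are \<open>m\<close>, \<open>m + 1\<close>, \<open>m + 2\<close>; their
  pendant vertices follow in consecutive pairs, so a block fills nine consecutive numbers.\<close>

definition triangle_at :: "nat \<Rightarrow> nat set set" where
  "triangle_at m = {{m, m + 1}, {m, m + 2}, {m + 1, m + 2}, {m, m + 3}, {m, m + 4},
     {m + 1, m + 5}, {m + 1, m + 6}, {m + 2, m + 7}, {m + 2, m + 8}}"

text \<open>Every pair meeting one of the \<open>n div 9\<close> blocks is forced, so
  \<open>X\<close> consists of the pairs among the fewer than nine leftover vertices, which start
  out isolated.\<close>

lemma sat_star_path_5:
  "sat_star n (path_graph 5) \<le> 9 * (n div 9) + ((n - 9 * (n div 9)) choose 2)"
proof -
  define q where "q = n div 9"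
  define E where "E = (\<Union>j<q. triangle_at (9 * j))"
  define X where "X = {e. e \<subseteq> {9 * q..<n} \<and> card e = 2}"
  have qn: "9 * q \<le> n" by (simp add: q_def)
  have div_9: "v div 9 = j" if "e \<in> triangle_at (9 * j)" "v \<in> e" for e v j
    using that unfolding triangle_at_def by (elim insertE emptyE) auto
  have block: "e \<in> triangle_at (9 * (v div 9)) \<and> v div 9 < q" if e: "e \<in> E" "v \<in> e" for e v
  proof -
    obtain j where j: "j < q" "e \<in> triangle_at (9 * j)" using e(1) by (auto simp: E_def)
    then show ?thesis using div_9[OF j(2) e(2)] by simp
  qed
  have simple: "simple_graph ({..<n}, E)"
  proof -
    have "e \<subseteq> {..<n} \<and> card e = 2" if e: "e \<in> E" for e
    proof -
      obtain j where j: "j < q" "e \<in> triangle_at (9 * j)" using e by (auto simp: E_def)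
      then have "9 * j + 8 < n" using qn by simp
      then show ?thesis using j(2) by (auto simp: triangle_at_def)
    qed
    then show ?thesis by (simp add: simple_graph_def)
  qed
  \<comment> \<open>Modulo 18 the vertex sum depends only on the place of an edge in its block: the
    sides give 1, 2, 3 and the pendant pairs 3, 4 then 6, 7 then 9, 10. The table maps these to the
    colouring described by \<open>coloured_triangle\<close>, with fourth colour 4.\<close>
  define c :: "nat set \<Rightarrow> nat" where
    "c e = (let s = \<Sum>e mod 18 in if s = 6 then 2 else if s = 7 \<or> s = 10 then 4
      else if s = 9 then 1 else s)" for e
  have c_vals: "c {9 * j, 9 * j + 1} = 1" "c {9 * j, 9 * j + 2} = 2" "c {9 * j + 1, 9 * j + 2} = 3"
    "c {9 * j, 9 * j + 3} = 3" "c {9 * j, 9 * j + 4} = 4" "c {9 * j + 1, 9 * j + 5} = 2"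
    "c {9 * j + 1, 9 * j + 6} = 4" "c {9 * j + 2, 9 * j + 7} = 1" "c {9 * j + 2, 9 * j + 8} = 4" for j
  proof -
    have s: "c {x, y} = (if r = 6 then 2 else if r = 7 \<or> r = 10 then 4 else if r = 9 then 1 else r)"
      if "x + y = 18 * j + r" "x \<noteq> y" "r < 18" for x y r :: nat
      using that by (simp add: c_def)
    show "c {9 * j, 9 * j + 1} = 1" using s[of "9 * j" "9 * j + 1" 1] by simp
    show "c {9 * j, 9 * j + 2} = 2" using s[of "9 * j" "9 * j + 2" 2] by simp
    show "c {9 * j + 1, 9 * j + 2} = 3" using s[of "9 * j + 1" "9 * j + 2" 3] by simp
    show "c {9 * j, 9 * j + 3} = 3" using s[of "9 * j" "9 * j + 3" 3] by simp
    show "c {9 * j, 9 * j + 4} = 4" using s[of "9 * j" "9 * j + 4" 4] by simp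
    show "c {9 * j + 1, 9 * j + 5} = 2" using s[of "9 * j + 1" "9 * j + 5" 6] by simp
    show "c {9 * j + 1, 9 * j + 6} = 4" using s[of "9 * j + 1" "9 * j + 6" 7] by simp
    show "c {9 * j + 2, 9 * j + 7} = 1" using s[of "9 * j + 2" "9 * j + 7" 9] by simp
    show "c {9 * j + 2, 9 * j + 8} = 4" using s[of "9 * j + 2" "9 * j + 8" 10] by simp
  qed
  have "proper E c"
    unfolding proper_def
  proof (intro ballI impI)
    fix e e' assume ee: "e \<in> E" "e' \<in> E" "e \<noteq> e' \<and> e \<inter> e' \<noteq> {}"
    then obtain v where "v \<in> e" "v \<in> e'" by blast
    define j where "j = v div 9"
    have "e \<in> triangle_at (9 * j)" "e' \<in> triangle_at (9 * j)"
      using block \<open>v \<in> e\<close> \<open>v \<in> e'\<close> ee by (auto simp: j_def)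
    then have "c e = c e' \<Longrightarrow> e = e' \<or> e \<inter> e' = {}"
      unfolding triangle_at_def by (elim insertE emptyE) (simp_all add: c_vals[simplified])
    then show "c e \<noteq> c e'" using ee(3) by blast
  qed
  moreover have "rainbow_free 5 E c"
    unfolding rainbow_free_def
  proof
    assume "\<exists>p. length p = 5 \<and> rainbow_path E c p"
    then obtain p where p: "length p = 5" "rainbow_path E c p" by blast
    then obtain x u v w y where p_eq: "p = [x, u, v, w, y]"
      by (auto simp: numeral_eq_Suc length_Suc_conv)
    define j where "j = v div 9"
    let ?T = "triangle_at (9 * j)"
    have d: "distinct [x, u, v, w, y]" and e: "{x, u} \<in> E" "{u, v} \<in> E" "{v, w} \<in> E" "{w, y} \<in> E"
      and dc: "distinct [c {x, u}, c {u, v}, c {v, w}, c {w, y}]"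
      using p(2) by (auto simp: p_eq rainbow_path_def)
    have T2: "{u, v} \<in> ?T" "{v, w} \<in> ?T" using block[OF e(2)] block[OF e(3)] by (auto simp: j_def)
    then have "u div 9 = j" "w div 9 = j" using div_9 by auto
    then have T4: "{x, u} \<in> ?T" "{w, y} \<in> ?T" using block[OF e(1), of u] block[OF e(4), of w] by auto
    have inner: "t \<in> {9 * j, 9 * j + 1, 9 * j + 2}"
      if "{s, t} \<in> ?T" "{t, r} \<in> ?T" "s \<noteq> r" for s t r
      using that unfolding triangle_at_def
      by (elim insertE emptyE) (auto simp: doubleton_eq_iff)
    have nb: "{s, 9 * j} \<in> ?T \<Longrightarrow> s \<in> {9 * j + 1, 9 * j + 2, 9 * j + 3, 9 * j + 4}"
      "{s, 9 * j + 1} \<in> ?T \<Longrightarrow> s \<in> {9 * j, 9 * j + 2, 9 * j + 5, 9 * j + 6}"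
      "{s, 9 * j + 2} \<in> ?T \<Longrightarrow> s \<in> {9 * j, 9 * j + 1, 9 * j + 7, 9 * j + 8}" for s
      by (auto simp: triangle_at_def doubleton_eq_iff)
    have "{y, w} \<in> ?T" using T4(2) by (simp add: insert_commute)
    have uvw: "u \<in> {9 * j, 9 * j + 1, 9 * j + 2}" "v \<in> {9 * j, 9 * j + 1, 9 * j + 2}"
      "w \<in> {9 * j, 9 * j + 1, 9 * j + 2}"
      using inner[OF T4(1) T2(1)] inner[OF T2] inner[OF T2(2) T4(2)] d by auto
    have c_vals': "c {9 * j + 1, 9 * j} = 1" "c {9 * j + 2, 9 * j} = 2" "c {9 * j + 2, 9 * j + 1} = 3"
      "c {9 * j + 3, 9 * j} = 3" "c {9 * j + 4, 9 * j} = 4" "c {9 * j + 5, 9 * j + 1} = 2"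
      "c {9 * j + 6, 9 * j + 1} = 4" "c {9 * j + 7, 9 * j + 2} = 1" "c {9 * j + 8, 9 * j + 2} = 4"
      using c_vals[of j] by (simp_all add: insert_commute)
    \<comment> \<open>The vertices \<open>u\<close>, \<open>v\<close>, \<open>w\<close> are the
      three corners and \<open>x\<close>, \<open>y\<close> are pendant. The edge at \<open>x\<close>
      repeats the colour of \<open>{v, w}\<close> or has colour 4, the edge at \<open>y\<close>
      repeats that of \<open>{u, v}\<close> or has colour 4, so some colour occurs twice.\<close>
    show False
      using uvw d dc nb[of x] nb[of y] T4(1) \<open>{y, w} \<in> ?T\<close>
      by (elim insertE emptyE) (auto simp: c_vals[simplified] c_vals'[simplified])
  qed
  ultimately have "sat_star n (path_graph 5) \<le> card E + card X"
  proof (intro sat_star_path_le[OF simple])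
    fix e c' assume e: "e \<in> non_edges ({..<n}, E) - X" and c': "proper (insert e E) c'"
    then have "\<not> e \<subseteq> {9 * q..<n}" "e \<subseteq> {..<n}" by (auto simp: non_edges_def X_def)
    then obtain u where u: "u \<in> e" "u < 9 * q" by fastforce
    then obtain z where z: "e = {z, u}" "z \<noteq> u" using e by (auto simp: non_edges_def card_2_iff)
    define m where "m = 9 * (u div 9)"
    have "u div 9 < q" using u(2) by (simp add: less_mult_imp_div_less mult.commute)
    then have sub: "triangle_at m \<subseteq> E" by (auto simp: E_def m_def)
    have "\<exists>r<9. u = m + r" unfolding m_def
      by (intro exI[of _ "u mod 9"]) simp
    then have um: "u \<in> {m, m + 1, m + 2, m + 3, m + 4, m + 5, m + 6, m + 7, m + 8}" by auto
    have dist: "distinct [m, m + 1, m + 2, m + 3, m + 4, m + 5, m + 6, m + 7, m + 8]" by simp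
    have sub': "triangle_at m \<subseteq> insert e E" using sub by blast
    have new: "{z, u} \<in> insert e E" "{z, u} \<notin> triangle_at m"
      using z e sub by (auto simp: non_edges_def)
    show "\<not> rainbow_free 5 (insert e E) c'"
      by (rule triangle_forced[OF c' dist sub'[unfolded triangle_at_def] um new(1) z(2)
            new(2)[unfolded triangle_at_def]])
  qed (auto simp: X_def)
  also have "card E \<le> 9 * q"
  proof -
    have "card (triangle_at m) \<le> 9" for m
    proof -
      define es where "es = [{m, m + 1}, {m, m + 2}, {m + 1, m + 2}, {m, m + 3}, {m, m + 4},
        {m + 1, m + 5}, {m + 1, m + 6}, {m + 2, m + 7}, {m + 2, m + 8}]"
      have "triangle_at m = set es" "length es = 9" by (simp_all add: triangle_at_def es_def)
      then show ?thesis using card_length[of es] by simp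
    qed
    then have "(\<Sum>j<q. card (triangle_at (9 * j))) \<le> (\<Sum>j<q. 9)" by (intro sum_mono) simp
    moreover have "card E \<le> (\<Sum>j<q. card (triangle_at (9 * j)))"
      unfolding E_def by (rule card_UN_le) simp
    ultimately show ?thesis by simp
  qed
  also have "card X = (n - 9 * q) choose 2"
    unfolding X_def using n_subsets[of "{9 * q..<n}" 2] by simp
  finally show ?thesis by (simp add: q_def)
qed

section \<open>The upper bound\<close>

lemma pow4_bound: "16 * (3 * m + 1) \<le> 4 ^ (m + 2)" for m :: nat
proof (induction m)
  case (Suc m)
  then show ?case by simp
qed simp

text \<open>The left side counts the bipartite edges and the pairs inside the small part;
  \<open>6 * m + 11\<close> is the number of non-leaf vertices, which bring no pendant edges of
  their own. Equality holds at \<open>m = 0\<close>, that is for \<open>k = 7\<close>.\<close>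

lemma gadget_size:
  fixes m :: nat
  shows "(m + 2) * (5 * m + 9) + ((m + 2) choose 2) \<le> (2 * m + 2) * 4 ^ (m + 1) + (6 * m + 11)"
proof -
  have "4 * (3 * m + 1) \<le> 4 ^ (m + 1)" using pow4_bound[of m] by simp
  then have "(2 * m + 2) * (4 * (3 * m + 1)) \<le> (2 * m + 2) * 4 ^ (m + 1)" by (rule mult_le_mono2)
  moreover have "2 * ((m + 2) choose 2) \<le> (m + 2) * (m + 1)" by (simp add: choose_two)
  moreover have "2 * ((m + 2) * (5 * m + 9)) + (m + 2) * (m + 1) \<le>
      2 * ((2 * m + 2) * (4 * (3 * m + 1))) + 2 * (6 * m + 11)"
    by (simp add: algebra_simps)
  moreover have "p + q \<le> s + u" if "r \<le> s" "2 * q \<le> w" "2 * p + w \<le> 2 * r + 2 * u"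
    for p q r s u w :: nat
    using that by linarith
  ultimately show ?thesis by blast
qed

lemma add_diff_le_add: "a + (n - l) + b \<le> n + d" if "a + b \<le> d + l" "l \<le> n" for a b d l n :: nat
  using that by linarith

lemma sat_star_path_odd:
  assumes n: "n \<ge> (2 * m + 8) * 2 ^ (2 * m + 3)"
  shows "sat_star n (path_graph (2 * m + 7)) \<le> n + (2 * m + 2) * 2 ^ (2 * m + 2)"
proof -
  let ?A = "{..<m + 2}" and ?B = "{m + 2..<6 * m + 11}" and ?L = "{6 * m + 11..<n}"
  have "(2 * m + 8) * (8 * (3 * m + 1)) \<le> (2 * m + 8) * 2 ^ (2 * m + 3)"
    using pow4_bound[of m] by (intro mult_le_mono2) (simp add: power_add power_mult)
  moreover have "10 * m + 23 \<le> (2 * m + 8) * (8 * (3 * m + 1))" by (simp add: algebra_simps)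
  \<comment> \<open>Besides the \<open>6 * m + 11\<close> vertices of the two parts there must be
    \<open>4 * m + 12\<close> leaves, one more than \<open>4 * card ?A + 3\<close>.\<close>
  ultimately have large: "10 * m + 23 \<le> n" using n by linarith
  interpret pendant_bipartite ?A ?B ?L "{m + 2}" "\<lambda>_. m + 2" "2 * m + 7"
  proof
    show "4 * card ?A + 3 < card {x \<in> ?L. m + 2 = p}" if "p \<in> {m + 2}" for p
    proof -
      have "{x \<in> ?L. m + 2 = p} = ?L" using that by auto
      then show ?thesis using large by simp
    qed
  qed auto
  have cards: "card ?A = m + 2" "card ?B = 5 * m + 9" "card ?L = n - (6 * m + 11)" by simp_all
  have total: "m + 2 + (5 * m + 9) + (n - (6 * m + 11)) = n" using large by simp
  have "sat_star n (path_graph (2 * m + 7)) \<le> (m + 2) * (5 * m + 9) + (n - (6 * m + 11)) + ((m + 2) choose 2)"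
    using sat_star_pendant_bipartite[OF pendant_bipartite_axioms] unfolding cards total .
  also have "\<dots> \<le> n + (2 * m + 2) * 4 ^ (m + 1)"
    by (rule add_diff_le_add[OF gadget_size]) (use large in simp)
  also have "(4 :: nat) ^ (m + 1) = 2 ^ (2 * m + 2)"
    using power_mult[of "2 :: nat" 2 "m + 1"] by simp
  finally show ?thesis .
qed

lemma sat_star_path_even:
  assumes n: "n \<ge> (2 * m + 9) * 2 ^ (2 * m + 4)"
  shows "sat_star n (path_graph (2 * m + 8)) \<le> n + (2 * m + 3) * 2 ^ (2 * m + 3)"
proof -
  let ?A = "{..<m + 2}" and ?B = "{m + 2..<6 * m + 11}" and ?L = "{6 * m + 11..<n}"
  define t where "t = 5 * m + 9"
  \<comment> \<open>The leaves are dealt cyclically to the \<open>t\<close> vertices of the large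
    part.\<close>
  let ?par = "\<lambda>x. m + 2 + (x - (6 * m + 11)) mod t"
  have "(2 * m + 9) * (16 * (3 * m + 1)) \<le> (2 * m + 9) * 2 ^ (2 * m + 4)"
    using pow4_bound[of m] by (intro mult_le_mono2) (simp add: power_add power_mult)
  moreover have "6 * m + 11 + t * (4 * m + 12) \<le> (2 * m + 9) * (16 * (3 * m + 1))"
    by (simp add: algebra_simps t_def)
  \<comment> \<open>This leaves \<open>4 * m + 12\<close> full rounds of dealing, hence that many
    leaves at each vertex of the large part.\<close>
  ultimately have large: "6 * m + 11 + t * (4 * m + 12) \<le> n" using n by linarith
  have t: "0 < t" by (simp add: t_def)
  interpret pendant_bipartite ?A ?B ?L ?B ?par "2 * m + 8"
  proof
    show "?par ` ?L \<subseteq> ?B"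
    proof
      fix y assume "y \<in> ?par ` ?L"
      then obtain x where "y = m + 2 + (x - (6 * m + 11)) mod t" by blast
      then show "y \<in> ?B" using mod_less_divisor[OF t, of "x - (6 * m + 11)"] by (simp add: t_def)
    qed
    show "4 * card ?A + 3 < card {x \<in> ?L. ?par x = p}" if p: "p \<in> ?B" for p
    proof -
      let ?f = "\<lambda>j. 6 * m + 11 + (j * t + (p - (m + 2)))"
      have pt: "p - (m + 2) < t" using p by (auto simp: t_def)
      have "?f ` {..<4 * m + 12} \<subseteq> {x \<in> ?L. ?par x = p}"
      proof
        fix x assume "x \<in> ?f ` {..<4 * m + 12}"
        then obtain j where j: "j < 4 * m + 12" "x = ?f j" by auto
        have "Suc j * t \<le> (4 * m + 12) * t" using j(1) by (intro mult_le_mono1) simp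
        then have "x < n" using j(2) large pt by (simp add: mult.commute)
        moreover have "?par x = p"
        proof -
          have "(x - (6 * m + 11)) mod t = (p - (m + 2)) mod t" by (simp add: j(2))
          also have "\<dots> = p - (m + 2)" using pt by simp
          finally have "?par x = m + 2 + (p - (m + 2))" by (rule arg_cong)
          also have "\<dots> = p" using p by (intro le_add_diff_inverse) simp
          finally show ?thesis .
        qed
        moreover have "6 * m + 11 \<le> x" by (simp add: j(2))
        ultimately show "x \<in> {x \<in> ?L. ?par x = p}"
          by (intro CollectI conjI) (simp_all only: atLeastLessThan_iff)
      qed
      then have "card (?f ` {..<4 * m + 12}) \<le> card {x \<in> ?L. ?par x = p}"
        by (intro card_mono) auto
      moreover have "inj_on ?f {..<4 * m + 12}" using t by (auto simp: inj_on_def)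
      ultimately show ?thesis by (simp add: card_image)
    qed
  qed auto
  have cards: "card ?A = m + 2" "card ?B = 5 * m + 9" "card ?L = n - (6 * m + 11)" by simp_all
  have total: "m + 2 + (5 * m + 9) + (n - (6 * m + 11)) = n" using large by simp
  have "sat_star n (path_graph (2 * m + 8)) \<le> (m + 2) * (5 * m + 9) + (n - (6 * m + 11)) + ((m + 2) choose 2)"
    using sat_star_pendant_bipartite[OF pendant_bipartite_axioms] unfolding cards total .
  also have "\<dots> \<le> n + (2 * m + 2) * 4 ^ (m + 1)"
    by (rule add_diff_le_add[OF gadget_size]) (use large in simp)
  \<comment> \<open>The parts have the same sizes as for \<open>k - 1\<close>, so the odd estimate
    is merely weakened.\<close>
  also have "(2 * m + 2) * 4 ^ (m + 1) \<le> (2 * m + 3) * 2 ^ (2 * m + 3)"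
    using power_mult[of "2 :: nat" 2 "m + 1"] by (intro mult_le_mono) (simp_all add: power_add)
  finally show ?thesis by simp
qed

lemma sat_star_path_upper:
  assumes "k \<ge> 5" "n \<ge> (k + 1) * 2 ^ (k - 4)"
  shows "sat_star n (path_graph k) \<le>
    (if k = 5 then 9 * (n div 9) + ((n - 9 * (n div 9)) choose 2) else n + (k - 5) * 2 ^ (k - 5))"
proof -
  consider "k = 5" | "k = 6" | "7 \<le> k" "odd k" | "7 \<le> k" "even k" using assms(1) by fastforce
  then show ?thesis
  proof cases
    case 1
    then show ?thesis using sat_star_path_5[of n] by simp
  next
    case 2
    then show ?thesis using sat_star_path_6[of n] assms(2) by simp
  next
    case 3
    define m where "m = (k - 7) div 2"
    have k: "k = 2 * m + 7" using 3 unfolding m_def by presburger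
    then have eqs: "k + 1 = 2 * m + 8" "k - 4 = 2 * m + 3" "k - 5 = 2 * m + 2" "k \<noteq> 5" by auto
    have "sat_star n (path_graph k) \<le> n + (k - 5) * 2 ^ (k - 5)"
      using sat_star_path_odd[OF assms(2)[unfolded eqs(1,2)]] unfolding eqs(3) unfolding k .
    then show ?thesis using eqs(4) by simp
  next
    case 4
    define m where "m = (k - 8) div 2"
    have k: "k = 2 * m + 8" using 4 unfolding m_def by presburger
    then have eqs: "k + 1 = 2 * m + 9" "k - 4 = 2 * m + 4" "k - 5 = 2 * m + 3" "k \<noteq> 5" by auto
    have "sat_star n (path_graph k) \<le> n + (k - 5) * 2 ^ (k - 5)"
      using sat_star_path_even[OF assms(2)[unfolded eqs(1,2)]] unfolding eqs(3) unfolding k .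
    then show ?thesis using eqs(4) by simp
  qed
qed

lemma sat_star_path_lower: "k \<ge> 5 \<Longrightarrow> n - 1 \<le> sat_star n (path_graph k)"
  by (rule sat_star_path_ge) (use saturated_path_edges_ge in fastforce)+

theorem corollary1p4:
  "(\<forall>k n :: nat. k \<ge> 5 \<and> n \<ge> (k + 1) * 2 ^ (k - 4) \<longrightarrow>
      n - 1 \<le> sat_star n (path_graph k) \<and>
      sat_star n (path_graph k) \<le>
        (if k = 5 then 9 * (n div 9) + ((n - 9 * (n div 9)) choose 2)
         else n + (k - 5) * 2 ^ (k - 5))) \<and>
   (\<forall>k :: nat. k \<ge> 5 \<longrightarrow>
      (\<lambda>n. real (sat_star n (path_graph k)) - real n) \<in> O(\<lambda>_. 1)) \<and>
   infinite {n :: nat. sat_star n (path_graph 5) = n - 1}"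
proof (intro conjI allI impI)
  fix k n :: nat
  assume k: "5 \<le> k \<and> (k + 1) * 2 ^ (k - 4) \<le> n"
  then show "n - 1 \<le> sat_star n (path_graph k)" by (intro sat_star_path_lower) simp
  show "sat_star n (path_graph k) \<le> (if k = 5 then 9 * (n div 9) + ((n - 9 * (n div 9)) choose 2)
      else n + (k - 5) * 2 ^ (k - 5))"
    using k by (intro sat_star_path_upper) auto
next
  fix k :: nat
  assume k: "5 \<le> k"
  \<comment> \<open>For \<open>k = 5\<close> at most eight vertices are left over, giving at most 28
    pairs; the other summand is the bound for \<open>k \<ge> 6\<close>.\<close>
  let ?K = "28 + (k - 5) * 2 ^ (k - 5)"
  have "\<bar>real (sat_star n (path_graph k)) - real n\<bar> \<le> real ?K" if n: "n \<ge> (k + 1) * 2 ^ (k - 4)" for n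
  proof -
    have "(n - 9 * (n div 9)) choose 2 \<le> 28"
    proof -
      define r where "r = n - 9 * (n div 9)"
      have "r = n mod 9" by (simp add: r_def minus_mult_div_eq_mod)
      then have "r \<le> 8" "r - 1 \<le> 7" using mod_less_divisor[of 9 n] by auto
      then have "r * (r - 1) \<le> 8 * 7" by (rule mult_le_mono)
      then show ?thesis unfolding r_def[symmetric] choose_two by linarith
    qed
    moreover have "9 * (n div 9) \<le> n" by simp
    ultimately have "sat_star n (path_graph k) \<le> n + ?K"
      using sat_star_path_upper[OF k n] by (auto split: if_splits)
    moreover have "n - 1 \<le> sat_star n (path_graph k)" by (rule sat_star_path_lower[OF k])
    ultimately show ?thesis by linarith
  qed
  then show "(\<lambda>n. real (sat_star n (path_graph k)) - real n) \<in> O(\<lambda>_. 1)"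
    by (intro bigoI[of _ "real ?K"] eventually_at_top_linorderI[of "(k + 1) * 2 ^ (k - 4)"]) simp
next
  \<comment> \<open>The residue 1 modulo 9 leaves a single vertex over, so no further edges are
    counted and \<open>9 * (q + 2)\<close> is one less than the number of vertices.\<close>
  have eq: "sat_star (9 * q + 19) (path_graph 5) = 9 * q + 19 - 1" for q
  proof -
    have "(9 * q + 19) div 9 = q + 2" by presburger
    then have "sat_star (9 * q + 19) (path_graph 5) \<le> 9 * q + 18"
      using sat_star_path_5[of "9 * q + 19"] by (simp add: binomial_eq_0)
    moreover have "9 * q + 19 - 1 \<le> sat_star (9 * q + 19) (path_graph 5)"
      by (rule sat_star_path_lower) simp
    ultimately show ?thesis by simp
  qed
  have "infinite (range (\<lambda>q :: nat. 9 * q + 19))"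
    by (simp add: finite_image_iff inj_on_def)
  moreover have "range (\<lambda>q. 9 * q + 19) \<subseteq> {n. sat_star n (path_graph 5) = n - 1}"
    using eq by blast
  ultimately show "infinite {n :: nat. sat_star n (path_graph 5) = n - 1}"
    using infinite_super by blast
qed

end
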